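(* Let $2\le r<s\le 3r+1$ and $k>r$ be integers. Let $t\ge r$ be the largest integer for which $$\frac{t}{t-r}\left(1-\frac1t\right)^{s}>1$$ (possibly $t=r$, where the left side is interpreted as $+\infty$), and let $\ell=\min\{k-1,t\}$. Then $i_k(T(s,r))$ is uniquely attained by $W[\frac1\ell,\ldots,\frac1\ell]$ (with $\ell$ parts). In particular, $i(T(s,r))$ is uniquely attained by $W[\frac1t,\ldots,\frac1t]$ (with $t$ parts). Furthermore, writing $s=pr+q$ with $0\le q<r$, $$i_k(T(s,r))=\frac{\ell!\,s!}{(\ell-r)!\,(r-q)!\,q!\,(p!)^r\,(p+1)^q\,\ell^{s}}$$ and $$i(T(s,r))=\frac{t!\,s!}{(t-r)!\,(r-q)!\,q!\,(p!)^r\,(p+1)^q\,t^{s}}.$$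
   Context: All graphs are finite and simple. $T(s,r)$ is the Turán graph: the complete $r$-partite graph on $s$ vertices whose part sizes differ by at most one. For graphs $F,G$, $P(F,G)$ is the number of $|V(F)|$-subsets of $V(G)$ inducing a subgraph isomorphic to $F$, and $p(F,G)=P(F,G)/\binom{|V(G)|}{|V(F)|}$. $i(F,n)$ is the maximum of $p(F,G)$ over all $n$-vertex graphs $G$, and $i_k(F,n)$ is the maximum over all $n$-vertex graphs not containing $K_k$ as a subgraph; $i(F)=\lim_{n\to\infty}i(F,n)$ and $i_k(F)=\lim_{n\to\infty}i_k(F,n)$ (the limits exist). For $x_1,\ldots,x_m>0$ with $\sum x_i=1$, the complete $m$-partite graphon $W[x_1,\ldots,x_m]:[0,1]^2\to\{0,1\}$ is obtained by partitioning $[0,1]$ into intervals of lengths $x_1,\ldots,x_m$ and setting $W(x,y)=1$ iff $x,y$ lie in distinct intervals. The induced density of $F$ in $W$ is the probability that $|V(F)|$ independent uniform points of $[0,1]$ induce a copy of $F$, where distinct $u,v$ are adjacent iff $W(u,v)=1$. $i_k(F)$ (respectively $i(F)$) is attained by $W$ if the induced density of $F$ in $W$ equals $i_k(F)$ (respectively $i(F)$). "Uniquely attained" means that it is the only one, up to reordering the parts, among complete $m$-partite graphons with $m<k$ (for $i_k$), respectively among complete $m$-partite graphons with $m$ an arbitrary positive integer (for $i$). *)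

theory Defs
  imports "HOL-Probability.Probability" "HOL-Library.Multiset"
begin

section \<open>Finite simple graphs\<close>

type_synonym 'a sgraph = "'a set \<times> 'a set set"

abbreviation verts :: "'a sgraph \<Rightarrow> 'a set" where "verts \<equiv> fst"

abbreviation edges :: "'a sgraph \<Rightarrow> 'a set set" where "edges \<equiv> snd"

definition all_pairs :: "'a set \<Rightarrow> 'a set set" where
  "all_pairs A = {e. e \<subseteq> A \<and> card e = 2}"

definition simple_graph :: "'a sgraph \<Rightarrow> bool" where
  "simple_graph G \<longleftrightarrow> finite (verts G) \<and> edges G \<subseteq> all_pairs (verts G)"

definition induced_subgraph :: "'a sgraph \<Rightarrow> 'a set \<Rightarrow> 'a sgraph" where
  "induced_subgraph G S = (S, {e \<in> edges G. e \<subseteq> S})"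

definition isomorphic :: "'a sgraph \<Rightarrow> 'b sgraph \<Rightarrow> bool" where
  "isomorphic G H \<longleftrightarrow> (\<exists>f. bij_betw f (verts G) (verts H) \<and>
     (\<forall>u\<in>verts G. \<forall>v\<in>verts G. {u, v} \<in> edges G \<longleftrightarrow> {f u, f v} \<in> edges H))"

definition contains_complete :: "nat \<Rightarrow> 'a sgraph \<Rightarrow> bool" where
  "contains_complete k G \<longleftrightarrow> (\<exists>S\<subseteq>verts G. card S = k \<and> all_pairs S \<subseteq> edges G)"

text \<open>
  The Turan graph \<open>T(s,r)\<close> is only determined up to isomorphism; the predicate holds of all
  its copies. The map \<open>c\<close> sends each vertex to the index of its part.
\<close>

definition is_turan_graph :: "nat \<Rightarrow> nat \<Rightarrow> 'a sgraph \<Rightarrow> bool" where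
  "is_turan_graph s r G \<longleftrightarrow> simple_graph G \<and> card (verts G) = s \<and>
     (\<exists>c. c ` verts G \<subseteq> {..<r} \<and>
        edges G = {{u, v} | u v. u \<in> verts G \<and> v \<in> verts G \<and> c u \<noteq> c v} \<and>
        (\<forall>i<r. \<forall>j<r. card {v \<in> verts G. c v = i} \<le> card {v \<in> verts G. c v = j} + 1))"

lemma card_residue_class:
  fixes r s i :: nat
  assumes "i < r"
  shows "s div r \<le> card {v. v < s \<and> v mod r = i}"
    and "card {v. v < s \<and> v mod r = i} \<le> s div r + 1"
proof -
  let ?A = "{v. v < s \<and> v mod r = i}" and ?g = "\<lambda>d. d * r + i"
  have inj: "inj_on ?g B" for B
    using assms by (auto simp: inj_on_def)
  have "?g d < s" if "d < s div r" for d
  proof -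
    have "?g d < (d + 1) * r" using assms by simp
    also have "\<dots> \<le> (s div r) * r" using that by (intro mult_right_mono) auto
    finally show ?thesis using div_times_less_eq_dividend[of s r] by linarith
  qed
  then have "?g ` {..<s div r} \<subseteq> ?A" using assms by auto
  then have "card (?g ` {..<s div r}) \<le> card ?A" by (intro card_mono) auto
  then show "s div r \<le> card ?A" by (simp add: card_image inj)
  have "?A \<subseteq> ?g ` {..s div r}"
  proof
    fix v assume "v \<in> ?A"
    then have "v = ?g (v div r)" "v div r \<le> s div r" by (auto simp: div_le_mono)
    then show "v \<in> ?g ` {..s div r}" by blast
  qed
  then have "card ?A \<le> card (?g ` {..s div r})" by (intro card_mono) auto
  then show "card ?A \<le> s div r + 1" by (simp add: card_image inj)
qed

lemma is_turan_graph_mod: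
  assumes "r > 0"
  shows "is_turan_graph s r ({..<s}, {{u, v} | u v. u < s \<and> v < s \<and> u mod r \<noteq> v mod r})"
  unfolding is_turan_graph_def
proof (intro conjI exI[of _ "\<lambda>v. v mod r"] allI impI)
  fix i j assume "i < r" "j < r"
  then show "card {v \<in> verts ({..<s}, {{u, v} | u v. u < s \<and> v < s \<and> u mod r \<noteq> v mod r}). v mod r = i}
    \<le> card {v \<in> verts ({..<s}, {{u, v} | u v. u < s \<and> v < s \<and> u mod r \<noteq> v mod r}). v mod r = j} + 1"
    using card_residue_class(2)[of i r s] card_residue_class(1)[of j r s] by simp
qed (use assms in \<open>auto simp: simple_graph_def all_pairs_def card_2_iff\<close>)


section \<open>Inducibility\<close>

definition induced_copies :: "'a sgraph \<Rightarrow> 'b sgraph \<Rightarrow> nat" where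
  "induced_copies F G = card {S. S \<subseteq> verts G \<and> card S = card (verts F) \<and>
     isomorphic (induced_subgraph G S) F}"

definition induced_freq :: "'a sgraph \<Rightarrow> 'b sgraph \<Rightarrow> real" where
  "induced_freq F G =
     real (induced_copies F G) / real (card (verts G) choose card (verts F))"

text \<open>
  Host graphs have natural numbers as vertices; every finite graph is isomorphic to such a graph.
  The sets below are finite because, for fixed \<open>F\<close> and \<open>n\<close>, the numerator of
  \<open>induced_freq F G\<close> is a natural number bounded by \<open>2 ^ n\<close> and the denominator is fixed.
\<close>

definition max_freq :: "'a sgraph \<Rightarrow> nat \<Rightarrow> real" where
  "max_freq F n =
     Max {induced_freq F G | G :: nat sgraph. simple_graph G \<and> card (verts G) = n}"

definition max_freq_free :: "nat \<Rightarrow> 'a sgraph \<Rightarrow> nat \<Rightarrow> real" where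
  "max_freq_free k F n =
     Max {induced_freq F G | G :: nat sgraph.
       simple_graph G \<and> card (verts G) = n \<and> \<not> contains_complete k G}"

definition inducibility :: "'a sgraph \<Rightarrow> real" where
  "inducibility F = lim (max_freq F)"

definition inducibility_free :: "nat \<Rightarrow> 'a sgraph \<Rightarrow> real" where
  "inducibility_free k F = lim (max_freq_free k F)"


section \<open>Complete multipartite graphons\<close>

definition part_weights :: "real list \<Rightarrow> bool" where
  "part_weights xs \<longleftrightarrow> (\<forall>x\<in>set xs. x > 0) \<and> sum_list xs = 1"

text \<open>All intervals are half-open, except that the last one contains the point \<open>1\<close>.\<close>

definition part_interval :: "real list \<Rightarrow> nat \<Rightarrow> real set" where
  "part_interval xs i =
     (if Suc i = length xs then {sum_list (take i xs)..1}
      else {sum_list (take i xs)..<sum_list (take (Suc i) xs)})"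

definition multipartite_graphon :: "real list \<Rightarrow> real \<Rightarrow> real \<Rightarrow> real" where
  "multipartite_graphon xs u v =
     (if \<exists>i<length xs. \<exists>j<length xs. i \<noteq> j \<and> u \<in> part_interval xs i \<and> v \<in> part_interval xs j
      then 1 else 0)"

definition sampled_graph :: "(real \<Rightarrow> real \<Rightarrow> real) \<Rightarrow> nat \<Rightarrow> (nat \<Rightarrow> real) \<Rightarrow> nat sgraph" where
  "sampled_graph W n x =
     ({..<n}, {{i, j} | i j. i < n \<and> j < n \<and> i \<noteq> j \<and> W (x i) (x j) = 1})"

definition induced_density :: "'a sgraph \<Rightarrow> (real \<Rightarrow> real \<Rightarrow> real) \<Rightarrow> real" where
  "induced_density F W =
     (let n = card (verts F) in
      \<P>(x in Pi\<^sub>M {..<n} (\<lambda>_. uniform_measure lborel {0..1}).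
         isomorphic (sampled_graph W n x) F))"

text \<open>
  Uniqueness is up to reordering of the parts, so the lists of part lengths are compared as
  multisets. A list satisfying \<open>part_weights\<close> is nonempty.
\<close>

definition uniquely_attains_free :: "nat \<Rightarrow> 'a sgraph \<Rightarrow> real list \<Rightarrow> bool" where
  "uniquely_attains_free k F xs \<longleftrightarrow>
     part_weights xs \<and> length xs < k \<and>
     induced_density F (multipartite_graphon xs) = inducibility_free k F \<and>
     (\<forall>ys. part_weights ys \<and> length ys < k \<and>
        induced_density F (multipartite_graphon ys) = inducibility_free k F \<longrightarrow>
        mset ys = mset xs)"

definition uniquely_attains :: "'a sgraph \<Rightarrow> real list \<Rightarrow> bool" where
  "uniquely_attains F xs \<longleftrightarrow>
     part_weights xs \<and>
     induced_density F (multipartite_graphon xs) = inducibility F \<and>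
     (\<forall>ys. part_weights ys \<and>
        induced_density F (multipartite_graphon ys) = inducibility F \<longrightarrow>
        mset ys = mset xs)"

end

theory Submission
  imports Defs "HOL-Combinatorics.Multiset_Permutations"
begin

text \<open>
  Let the target be the Turan graph with \<open>a = r - q\<close> parts of size \<open>p\<close> and \<open>b = q\<close> parts of size
  \<open>p + 1\<close>. Its induced density in the complete multipartite graphon with part lengths \<open>x i\<close> is a
  constant times the polynomial \<open>S x\<close>, the sum of \<open>(\<Prod>i\<in>A. x i ^ p) * (\<Prod>i\<in>B. x i ^ (p + 1))\<close> over
  all disjoint sets \<open>A\<close>, \<open>B\<close> of \<open>a\<close> and \<open>b\<close> parts (\<open>induced_density_multipartite\<close>). The proof
  maximises \<open>S\<close> over all weights and shows that graphs cannot do better than graphons of this kind.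

  \<^emph>\<open>Optimal weights are equal.\<close> Vary two weights with fixed sum. Then \<open>S\<close> is a function of their
  product, and a convex one: power sums of two nonnegative numbers with fixed sum are convex in the
  product, and all other terms are powers of the product with nonnegative coefficients. So the value of
  \<open>S\<close> is at most a weighted mean of its values after merging the two parts and after making them equal
  (\<open>turan_poly_merge_equalize\<close>). At a maximiser, which exists by compactness, two different positive
  weights can therefore be merged without loss, and playing two such merges against each other gives a
  contradiction (\<open>turan_poly_maximizer_equal\<close>).

  \<^emph>\<open>The number of parts.\<close> For \<open>u\<close> equal weights, the ratio of the value to that of \<open>u - 1\<close> equal
  weights is \<open>u / (u - r) * (1 - 1 / u) ^ s\<close>. In terms of \<open>z = 1 / u\<close> it exceeds \<open>1\<close> iff
  \<open>(1 - z) ^ s > 1 - r * z\<close>. Both sides agree at \<open>z = 0\<close> and the left one is convex, so the ratio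
  exceeds \<open>1\<close> exactly for \<open>r < u \<le> t\<close>; and it is never \<open>1\<close>, as \<open>u\<close> and \<open>u - 1\<close> are coprime. Hence
  the values strictly increase up to \<open>t\<close> and strictly decrease afterwards, and with at most \<open>M\<close> parts
  exactly \<open>min M t\<close> equal parts are optimal, provided that \<open>M \<ge> r\<close> (\<open>turan_poly_le_uniform_value\<close>).

  \<^emph>\<open>From graphs to graphons.\<close> In a copy of the target nonadjacent vertices are twins. Hence for
  nonadjacent vertices \<open>u\<close> and \<open>v\<close> of a host graph, at least one of two operations, replacing \<open>v\<close> by
  a clone of \<open>u\<close> and replacing \<open>u\<close> by a clone of \<open>v\<close>, does not decrease the number of copies, and
  neither of them creates larger cliques. So some complete multipartite host is optimal
  (\<open>exists_multipartite_with_more_copies\<close>), and without a complete subgraph on \<open>k\<close> vertices it has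
  fewer than \<open>k\<close> parts. Choosing \<open>s\<close> of its \<open>n\<close> vertices with
  replacement is sampling from a complete multipartite graphon, and the \<open>s\<close> vertices are distinct with
  probability tending to \<open>1\<close>. This bounds the frequency from above for all \<open>n\<close>
  (\<open>induced_freq_le\<close>), and balanced complete multipartite hosts attain the bound in the limit
  (\<open>frequency_limit\<close>).
\<close>

section \<open>The density polynomial\<close>

definition part_pairs :: "nat \<Rightarrow> nat \<Rightarrow> 'i set \<Rightarrow> ('i set \<times> 'i set) set" where
  "part_pairs a b I = {(A, B). A \<subseteq> I \<and> B \<subseteq> I \<and> A \<inter> B = {} \<and> card A = a \<and> card B = b}"

text \<open>
  Up to a constant factor, this is the probability that \<open>p * a + (p + 1) * b\<close> independent random
  points, each falling into part \<open>i\<close> with probability \<open>x i\<close>, hit exactly \<open>a + b\<close> parts: \<open>a\<close> of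
  them (the set \<open>A\<close>) exactly \<open>p\<close> times and \<open>b\<close> of them (the set \<open>B\<close>) exactly \<open>p + 1\<close> times. It is the monomial
  symmetric polynomial with exponents \<open>p\<close> (\<open>a\<close> times) and \<open>p + 1\<close> (\<open>b\<close> times).
\<close>

definition turan_poly :: "nat \<Rightarrow> nat \<Rightarrow> nat \<Rightarrow> 'i set \<Rightarrow> ('i \<Rightarrow> real) \<Rightarrow> real" where
  "turan_poly p a b I x =
     (\<Sum>(A, B)\<in>part_pairs a b I. (\<Prod>i\<in>A. x i ^ p) * (\<Prod>i\<in>B. x i ^ Suc p))"

lemma finite_part_pairs [simp]: "finite I \<Longrightarrow> finite (part_pairs a b I)"
  by (rule finite_subset[of _ "Pow I \<times> Pow I"]) (auto simp: part_pairs_def)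

lemma turan_poly_cong:
  assumes "\<And>i. i \<in> I \<Longrightarrow> x i = y i"
  shows "turan_poly p a b I x = turan_poly p a b I y"
  unfolding turan_poly_def part_pairs_def
  by (intro sum.cong refl) (auto intro!: arg_cong2[of _ _ _ _ "(*)"] prod.cong simp: assms subset_eq)

lemma turan_poly_nonneg:
  assumes "\<And>i. i \<in> I \<Longrightarrow> 0 \<le> x i"
  shows "0 \<le> turan_poly p a b I x"
  unfolding turan_poly_def part_pairs_def using assms
  by (auto intro!: sum_nonneg mult_nonneg_nonneg prod_nonneg simp: subset_eq)

text \<open>
  Split the pairs \<open>(A, B)\<close> by whether \<open>i\<close> lies in neither set, in \<open>A\<close>, or in \<open>B\<close>.
\<close>

lemma turan_poly_insert:
  assumes "finite I" "i \<notin> I"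
  shows "turan_poly p a b (insert i I) x = turan_poly p a b I x +
    (if a = 0 then 0 else x i ^ p * turan_poly p (a - 1) b I x) +
    (if b = 0 then 0 else x i ^ Suc p * turan_poly p a (b - 1) I x)"
proof -
  let ?f = "\<lambda>(A, B). (\<Prod>i\<in>A. x i ^ p) * (\<Prod>i\<in>B. x i ^ Suc p)"
  let ?P = "part_pairs a b (insert i I)"
  let ?L = "{(A, B) \<in> ?P. i \<in> A}" and ?R = "{(A, B) \<in> ?P. i \<in> B}"
  have fin: "finite A" if "A \<subseteq> insert i I" for A
    using that assms(1) by (meson finite_insert finite_subset)
  have finI: "finite A \<and> i \<notin> A" if "A \<subseteq> I" for A
    using that assms by (meson finite_subset subsetD)
  have fP: "finite ?P" "finite (part_pairs a b I)" using assms(1) by simp_all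
  then have fin': "finite ?L" "finite ?R" by (auto intro: finite_subset[OF _ fP(1)])
  have split: "?P = (part_pairs a b I \<union> ?L) \<union> ?R" by (auto simp: part_pairs_def)
  have disj: "(part_pairs a b I \<union> ?L) \<inter> ?R = {}" "part_pairs a b I \<inter> ?L = {}"
    using assms(2) by (auto simp: part_pairs_def)
  have "sum ?f ?P = sum ?f ((part_pairs a b I \<union> ?L) \<union> ?R)" using split by (rule arg_cong)
  also have "\<dots> = sum ?f (part_pairs a b I) + sum ?f ?L + sum ?f ?R"
    by (simp only: sum.union_disjoint[OF finite_UnI[OF fP(2) fin'(1)] fin'(2) disj(1)]
        sum.union_disjoint[OF fP(2) fin'(1) disj(2)])
  also have "sum ?f ?L = (if a = 0 then 0 else x i ^ p * turan_poly p (a - 1) b I x)"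
  proof (cases "a = 0")
    case True
    then have "w \<notin> ?L" for w using fin[of "fst w"] by (auto simp: part_pairs_def)
    then have "?L = {}" by blast
    with True show ?thesis by (simp only: sum.empty if_True simp_thms)
  next
    case False
    have "sum ?f ?L = (\<Sum>(A, B)\<in>part_pairs (a - 1) b I. x i ^ p * ?f (A, B))"
    proof (rule sum.reindex_bij_witness[of _ "\<lambda>(A, B). (insert i A, B)" "\<lambda>(A, B). (A - {i}, B)"])
      fix w assume w: "w \<in> ?L"
      then obtain A B where [simp]: "w = (A, B)" by (cases w)
      from w have A: "i \<in> A" "finite A" using fin by (auto simp: part_pairs_def)
      show "(case case w of (A, B) \<Rightarrow> (A - {i}, B) of (A, B) \<Rightarrow> x i ^ p * ?f (A, B)) = ?f w"
        by (simp add: prod.remove[OF A(2,1)] mult.assoc)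
    qed (use False fin finI assms in \<open>auto simp: part_pairs_def\<close>)
    with False show ?thesis
      by (simp add: turan_poly_def sum_distrib_left case_prod_unfold)
  qed
  also have "sum ?f ?R = (if b = 0 then 0 else x i ^ Suc p * turan_poly p a (b - 1) I x)"
  proof (cases "b = 0")
    case True
    then have "w \<notin> ?R" for w using fin[of "snd w"] by (auto simp: part_pairs_def)
    then have "?R = {}" by blast
    with True show ?thesis by (simp only: sum.empty if_True simp_thms)
  next
    case False
    have "sum ?f ?R = (\<Sum>(A, B)\<in>part_pairs a (b - 1) I. x i ^ Suc p * ?f (A, B))"
    proof (rule sum.reindex_bij_witness[of _ "\<lambda>(A, B). (A, insert i B)" "\<lambda>(A, B). (A, B - {i})"])
      fix w assume w: "w \<in> ?R"
      then obtain A B where [simp]: "w = (A, B)" by (cases w)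
      from w have B: "i \<in> B" "finite B" using fin by (auto simp: part_pairs_def)
      show "(case case w of (A, B) \<Rightarrow> (A, B - {i}) of (A, B) \<Rightarrow> x i ^ Suc p * ?f (A, B)) = ?f w"
        by (simp add: prod.remove[OF B(2,1)] mult_ac)
    qed (use False fin finI assms in \<open>auto simp: part_pairs_def\<close>)
    with False show ?thesis
      by (simp add: turan_poly_def sum_distrib_left case_prod_unfold)
  qed
  finally show ?thesis by (simp only: turan_poly_def)
qed

text \<open>
  As a function of two of its variables the polynomial involves them only through their power sums,
  their sum and their product, always with nonnegative coefficients. When the sum is kept fixed,
  everything is a function of the product.
\<close>

lemma turan_poly_two_coordinates:
  assumes "finite J" "i \<notin> J" "j \<notin> J" "i \<noteq> j" "\<And>k. k \<in> J \<Longrightarrow> 0 \<le> x k"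
  obtains A B C D E G :: real
  where "0 \<le> A" "0 \<le> B" "0 \<le> C" "0 \<le> D" "0 \<le> E" "0 \<le> G"
    and "\<And>y. (\<And>k. k \<in> J \<Longrightarrow> y k = x k) \<Longrightarrow> turan_poly p a b (insert i (insert j J)) y =
      A + B * (y i ^ p + y j ^ p) + C * (y i ^ Suc p + y j ^ Suc p) + D * (y i * y j) ^ p
      + E * ((y i + y j) * (y i * y j) ^ p) + G * (y i * y j) ^ Suc p"
proof -
  let ?Q = "\<lambda>a b. turan_poly p a b J x"
  let ?B = "if a = 0 then 0 else ?Q (a - 1) b" and ?C = "if b = 0 then 0 else ?Q a (b - 1)"
  let ?D = "if a < 2 then 0 else ?Q (a - 2) b" and ?G = "if b < 2 then 0 else ?Q a (b - 2)"
  let ?E = "if a = 0 \<or> b = 0 then 0 else ?Q (a - 1) (b - 1)"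
  have nn: "0 \<le> ?Q a b" for a b using assms by (auto intro: turan_poly_nonneg)
  show ?thesis
  proof (rule that[of "?Q a b" ?B ?C ?D ?E ?G])
    fix y assume "\<And>k. k \<in> J \<Longrightarrow> y k = x k"
    then have *: "turan_poly p a b J y = ?Q a b" for a b by (rule turan_poly_cong)
    show "turan_poly p a b (insert i (insert j J)) y =
      ?Q a b + ?B * (y i ^ p + y j ^ p) + ?C * (y i ^ Suc p + y j ^ Suc p) + ?D * (y i * y j) ^ p
      + ?E * ((y i + y j) * (y i * y j) ^ p) + ?G * (y i * y j) ^ Suc p"
    proof -
      have P: "turan_poly p a b (insert k J) y =
          ?Q a b + (if a = 0 then 0 else y k ^ p * ?Q (a - 1) b) +
          (if b = 0 then 0 else y k ^ Suc p * ?Q a (b - 1))" if "k \<notin> J" for k a b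
        using turan_poly_insert[OF assms(1) that, of p a b y] by (simp only: *)
      have ij: "finite (insert j J)" "i \<notin> insert j J" using assms by auto
      have "a = 0 \<or> a = 1 \<or> 2 \<le> a" "b = 0 \<or> b = 1 \<or> 2 \<le> b" by linarith+
      then show ?thesis
        unfolding turan_poly_insert[OF ij] P[OF assms(3)] power_mult_distrib power_Suc
        by (elim disjE; simp add: ring_distribs ac_simps numeral_2_eq_2)
    qed
  qed (use nn in auto)
qed

text \<open>
  The left-hand side is twice a polynomial in \<open>d\<^sup>2\<close> with nonnegative coefficients, hence convex in
  \<open>d\<^sup>2\<close>; the right-hand side is its chord between \<open>d\<^sup>2 = 0\<close> and \<open>d\<^sup>2 = 1\<close>. The proof uses the
  recurrence \<open>P (n + 2) = 2 * P (n + 1) - (1 - d\<^sup>2) * P n\<close> of the power sums instead of binomial sums.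
\<close>

lemma sum_powers_unit:
  fixes d :: real
  assumes "0 \<le> d" "d \<le> 1"
  shows "(1 + d) ^ Suc n + (1 - d) ^ Suc n \<le> d\<^sup>2 * 2 ^ Suc n + (1 - d\<^sup>2) * 2"
proof (induction n rule: induct_nat_012)
  case (ge2 n)
  have "1 + real (Suc n) * d \<le> (1 + d) ^ Suc n" using assms by (intro Bernoulli_inequality) auto
  moreover have "1 + real (Suc n) * (- d) \<le> (1 + - d) ^ Suc n" using assms by (intro Bernoulli_inequality) auto
  ultimately have "2 \<le> (1 + d) ^ Suc n + (1 - d) ^ Suc n" by simp
  moreover have "0 \<le> 1 - d\<^sup>2" using assms by (simp add: power_le_one)
  ultimately have "(1 - d\<^sup>2) * 2 \<le> (1 - d\<^sup>2) * ((1 + d) ^ Suc n + (1 - d) ^ Suc n)"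
    by (rule mult_left_mono)
  moreover have "(1 + d) ^ Suc (Suc (Suc n)) + (1 - d) ^ Suc (Suc (Suc n)) =
    2 * ((1 + d) ^ Suc (Suc n) + (1 - d) ^ Suc (Suc n)) - (1 - d\<^sup>2) * ((1 + d) ^ Suc n + (1 - d) ^ Suc n)"
    unfolding power_Suc by algebra
  ultimately show ?case using ge2(2) by (simp add: algebra_simps)
qed (auto simp: algebra_simps power2_eq_square)

text \<open>
  Here \<open>L\<close> is the product \<open>x * y\<close> relative to its largest possible value \<open>(c / 2)\<^sup>2\<close> for the given
  sum \<open>c\<close>. So \<open>L = 0\<close> when one of the numbers vanishes, \<open>L = 1\<close> when they are equal, and the
  inequality says that the power sum lies below its chord as a function of the product.
\<close>

lemma sum_powers_le_interpolation:
  fixes x y :: real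
  assumes "0 \<le> x" "0 \<le> y" "0 < x + y" "0 < n"
  defines "c \<equiv> x + y"
  defines "L \<equiv> 4 * x * y / c\<^sup>2"
  shows "x ^ n + y ^ n \<le> (1 - L) * c ^ n + L * (2 * (c / 2) ^ n)"
proof -
  define d where "d = \<bar>x - y\<bar> / c"
  have c: "c > 0" using assms by simp
  have d: "0 \<le> d" "d \<le> 1" using assms c by (auto simp: d_def c_def field_simps)
  have "(x - y)\<^sup>2 = c\<^sup>2 - 4 * x * y" unfolding c_def by algebra
  then have L: "1 - L = d\<^sup>2" using c by (simp add: L_def d_def power_divide diff_divide_distrib)
  have xy: "x ^ n + y ^ n = (c / 2) ^ n * ((1 + d) ^ n + (1 - d) ^ n)"
  proof (cases "x \<ge> y")
    case True
    then have "x = c / 2 * (1 + d)" "y = c / 2 * (1 - d)" using c by (auto simp: d_def c_def field_simps)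
    then have "x ^ n = (c / 2) ^ n * (1 + d) ^ n" "y ^ n = (c / 2) ^ n * (1 - d) ^ n"
      by (simp_all only: power_mult_distrib)
    then show ?thesis by (simp only: distrib_left)
  next
    case False
    then have "y = c / 2 * (1 + d)" "x = c / 2 * (1 - d)" using c by (auto simp: d_def c_def field_simps)
    then have "y ^ n = (c / 2) ^ n * (1 + d) ^ n" "x ^ n = (c / 2) ^ n * (1 - d) ^ n"
      by (simp_all only: power_mult_distrib)
    then show ?thesis by (simp only: distrib_left add.commute)
  qed
  obtain n' where n: "n = Suc n'" using assms(4) by (cases n) auto
  have "(c / 2) ^ n * ((1 + d) ^ n + (1 - d) ^ n) \<le> (c / 2) ^ n * (d\<^sup>2 * 2 ^ n + (1 - d\<^sup>2) * 2)"
    using sum_powers_unit[OF d, of n'] c unfolding n by (intro mult_left_mono) auto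
  also have "\<dots> = (1 - L) * c ^ n + L * (2 * (c / 2) ^ n)"
  proof -
    have "(c / 2) ^ n * 2 ^ n = c ^ n" by (simp add: power_divide)
    moreover have "L = 1 - d\<^sup>2" using L by simp
    moreover have "(c / 2) ^ n * (d\<^sup>2 * 2 ^ n + (1 - d\<^sup>2) * 2) =
        d\<^sup>2 * ((c / 2) ^ n * 2 ^ n) + (1 - d\<^sup>2) * (2 * (c / 2) ^ n)"
      by (simp add: ring_distribs)
    ultimately show ?thesis by (simp add: L)
  qed
  finally show ?thesis using xy by simp
qed

lemma power_mult_le_interpolation:
  fixes x y :: real
  assumes "0 \<le> x" "0 \<le> y" "0 < x + y" "0 < n"
  defines "c \<equiv> x + y"
  defines "L \<equiv> 4 * x * y / c\<^sup>2"
  shows "0 \<le> L" "L \<le> 1" "(x * y) ^ n \<le> L * (c / 2 * (c / 2)) ^ n"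
proof -
  have c: "c > 0" using assms by simp
  have "4 * x * y \<le> c\<^sup>2" using zero_le_power2[of "x - y"] by (simp add: c_def power2_eq_square algebra_simps)
  then show L: "0 \<le> L" "L \<le> 1" using assms(1,2) c by (auto simp: L_def)
  have "x * y = L * (c / 2 * (c / 2))" using c by (simp add: L_def power2_eq_square)
  then have "(x * y) ^ n = L ^ n * (c / 2 * (c / 2)) ^ n" by (metis power_mult_distrib)
  also have "\<dots> \<le> L * (c / 2 * (c / 2)) ^ n"
    using power_decreasing[of 1 n L] L assms(4) c by (intro mult_right_mono) auto
  finally show "(x * y) ^ n \<le> L * (c / 2 * (c / 2)) ^ n" .
qed

text \<open>
  The key inequality: with \<open>x i + x j\<close> fixed the polynomial is convex in the product \<open>x i * x j\<close>. The
  two ends of the range of that product correspond to merging the two parts into one and to making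
  them equal.
\<close>

lemma turan_poly_merge_equalize:
  assumes "finite I" "i \<in> I" "j \<in> I" "i \<noteq> j" "\<And>k. k \<in> I \<Longrightarrow> 0 \<le> x k" "0 < x i + x j" "0 < p"
  defines "c \<equiv> x i + x j"
  defines "L \<equiv> 4 * x i * x j / c\<^sup>2"
  shows "turan_poly p a b I x \<le>
    (1 - L) * turan_poly p a b I (x(i := c, j := 0)) +
    L * turan_poly p a b I (x(i := c / 2, j := c / 2))"
proof -
  let ?J = "I - {i, j}"
  have I: "I = insert i (insert j ?J)" using assms by auto
  obtain A B C D E G where nn: "0 \<le> A" "0 \<le> B" "0 \<le> C" "0 \<le> D" "0 \<le> E" "0 \<le> G"
    and eq: "\<And>y. (\<And>k. k \<in> ?J \<Longrightarrow> y k = x k) \<Longrightarrow> turan_poly p a b I y =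
      A + B * (y i ^ p + y j ^ p) + C * (y i ^ Suc p + y j ^ Suc p) + D * (y i * y j) ^ p
      + E * ((y i + y j) * (y i * y j) ^ p) + G * (y i * y j) ^ Suc p"
    using turan_poly_two_coordinates[of ?J i j x p a b, folded I] assms by (metis DiffD1 DiffD2 finite_Diff insertCI)
  have xi: "0 \<le> x i" "0 \<le> x j" using assms by auto
  note 1 = sum_powers_le_interpolation[OF xi assms(6), folded c_def, folded L_def]
  note 2 = power_mult_le_interpolation(3)[OF xi assms(6), folded c_def, folded L_def]
  note L = power_mult_le_interpolation(1,2)[OF xi assms(6,7), folded c_def, folded L_def]
  have c0: "0 < c" using assms by simp
  have e1: "turan_poly p a b I (x(i := c, j := 0)) = A + B * c ^ p + C * c ^ Suc p"
    using eq[of "x(i := c, j := 0)"] assms(4,7) by (simp add: zero_power)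
  let ?h = "c / 2"
  have e2: "turan_poly p a b I (x(i := ?h, j := ?h)) =
     A + B * (2 * ?h ^ p) + C * (2 * ?h ^ Suc p) + D * (?h * ?h) ^ p
      + E * (c * (?h * ?h) ^ p) + G * (?h * ?h) ^ Suc p"
    using eq[of "x(i := ?h, j := ?h)"] assms(4) by (simp flip: mult_2)
  have "turan_poly p a b I x = A + B * (x i ^ p + x j ^ p) + C * (x i ^ Suc p + x j ^ Suc p) + D * (x i * x j) ^ p
      + E * (c * (x i * x j) ^ p) + G * (x i * x j) ^ Suc p"
    unfolding c_def by (rule eq) simp
  also have "\<dots> \<le> A + B * ((1 - L) * c ^ p + L * (2 * ?h ^ p))
      + C * ((1 - L) * c ^ Suc p + L * (2 * ?h ^ Suc p)) + D * (L * (?h * ?h) ^ p)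
      + E * (c * (L * (?h * ?h) ^ p)) + G * (L * (?h * ?h) ^ Suc p)"
    using nn assms(7) c0 by (intro add_mono mult_left_mono 1 2) auto
  also have "\<dots> = (1 - L) * turan_poly p a b I (x(i := c, j := 0)) +
    L * turan_poly p a b I (x(i := c / 2, j := c / 2))"
  proof -
    have "A + B * ((1 - L) * u + L * u') + C * ((1 - L) * v + L * v') + D * (L * w) + E * (c * (L * w)) + G * (L * z)
      = (1 - L) * (A + B * u + C * v) + L * (A + B * u' + C * v' + D * w + E * (c * w) + G * z)"
      for u u' v v' w z by (simp add: algebra_simps)
    then show ?thesis unfolding e1 e2 by this
  qed
  finally show ?thesis .
qed

section \<open>Maximisers on the simplex are uniform\<close>

text \<open>
  Since the exponents are positive, a part of weight zero contributes nothing.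
\<close>

lemma turan_poly_support:
  assumes "finite I" "0 < p"
  shows "turan_poly p a b I x = turan_poly p a b {i \<in> I. x i \<noteq> 0} x"
  unfolding turan_poly_def
proof (rule sum.mono_neutral_right)
  show "finite (part_pairs a b I)" using assms by simp
  show "part_pairs a b {i \<in> I. x i \<noteq> 0} \<subseteq> part_pairs a b I" by (auto simp: part_pairs_def)
  show "\<forall>w\<in>part_pairs a b I - part_pairs a b {i \<in> I. x i \<noteq> 0}.
       (case w of (A, B) \<Rightarrow> (\<Prod>i\<in>A. x i ^ p) * (\<Prod>i\<in>B. x i ^ Suc p)) = 0"
  proof safe
    fix A B assume *: "(A, B) \<in> part_pairs a b I" "(A, B) \<notin> part_pairs a b {i \<in> I. x i \<noteq> 0}"
    then have "finite A" "finite B" using assms by (auto simp: part_pairs_def intro: finite_subset)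
    moreover from * obtain i where "i \<in> A \<or> i \<in> B" "x i = 0" by (auto simp: part_pairs_def)
    ultimately show "(\<Prod>i\<in>A. x i ^ p) * (\<Prod>i\<in>B. x i ^ Suc p) = 0"
      using assms(2) by (auto simp: zero_power intro!: prod_zero)
  qed
qed

lemma card_part_pairs:
  assumes "finite I"
  shows "card (part_pairs a b I) = (card I choose a) * ((card I - a) choose b)"
proof -
  have fin: "A \<subseteq> I \<Longrightarrow> finite A" for A using assms by (rule rev_finite_subset)
  have "part_pairs a b I = (SIGMA A:{A. A \<subseteq> I \<and> card A = a}. {B. B \<subseteq> I - A \<and> card B = b})"
    by (auto simp: part_pairs_def)
  then have "card (part_pairs a b I) = (\<Sum>A\<in>{A. A \<subseteq> I \<and> card A = a}. card {B. B \<subseteq> I - A \<and> card B = b})"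
    using assms by (simp add: card_SigmaI)
  also have "\<dots> = (\<Sum>A\<in>{A. A \<subseteq> I \<and> card A = a}. ((card I - a) choose b))"
    using assms fin by (intro sum.cong) (auto simp: n_subsets card_Diff_subset)
  finally show ?thesis using assms by (simp add: n_subsets)
qed

text \<open>
  The value of the polynomial for \<open>u\<close> equal weights \<open>1 / u\<close>.
\<close>

definition uniform_value :: "nat \<Rightarrow> nat \<Rightarrow> nat \<Rightarrow> nat \<Rightarrow> real" where
  "uniform_value p a b u = real (u choose a) * real ((u - a) choose b) / real u ^ (p * (a + b) + b)"

lemma turan_poly_uniform:
  assumes "finite I" "\<And>i. i \<in> I \<Longrightarrow> x i = 1 / real (card I)"
  shows "turan_poly p a b I x = uniform_value p a b (card I)"
proof -
  have "turan_poly p a b I x = turan_poly p a b I (\<lambda>_. 1 / real (card I))"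
    by (rule turan_poly_cong) (rule assms(2))
  also have "\<dots> = (\<Sum>(A, B)\<in>part_pairs a b I. (1 / real (card I)) ^ (p * a + Suc p * b))"
    unfolding turan_poly_def
    by (intro sum.cong refl) (auto simp: part_pairs_def power_add power_mult simp del: power_Suc mult_Suc)
  also have "p * a + Suc p * b = p * (a + b) + b" by (simp add: algebra_simps)
  finally show ?thesis
    using assms(1) by (simp add: uniform_value_def card_part_pairs power_one_over divide_inverse case_prod_unfold power_inverse)
qed

text \<open>
  The functions vanish outside \<open>I\<close>, which makes the simplex a compact subset of a product space
  even if the index type is infinite.
\<close>

definition simplex_on :: "'i set \<Rightarrow> ('i \<Rightarrow> real) set" where
  "simplex_on I = {x. (\<forall>i\<in>I. 0 \<le> x i) \<and> (\<forall>i. i \<notin> I \<longrightarrow> x i = 0) \<and> sum x I = 1}"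

lemma simplex_on_redistribute:
  assumes "x \<in> simplex_on I" "finite I" "i \<in> I" "j \<in> I" "i \<noteq> j" "0 \<le> u" "0 \<le> v" "u + v = x i + x j"
  shows "x(i := u, j := v) \<in> simplex_on I"
proof -
  have "sum f I = f i + f j + sum f (I - {i, j})" for f :: "'a \<Rightarrow> real"
  proof -
    have "I = insert i (insert j (I - {i, j}))" using assms by auto
    then have "sum f I = sum f (insert i (insert j (I - {i, j})))" by simp
    also have "\<dots> = f i + f j + sum f (I - {i, j})" using assms by simp
    finally show ?thesis .
  qed
  note * = this
  have "sum (x(i := u, j := v)) I = u + v + sum x (I - {i, j})"
    using assms(5) by (subst *) (auto intro!: sum.cong)
  also have "\<dots> = 1" using assms(1,8) *[of x] by (simp add: simplex_on_def)
  finally show ?thesis using assms by (auto simp: simplex_on_def)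
qed

lemma compact_simplex_on:
  fixes I :: "'i set"
  assumes "finite I"
  shows "compact (simplex_on I)"
proof -
  let ?S = "\<lambda>i. if i \<in> I then {0..1::real} else {0}"
  have "compactin (product_topology (\<lambda>i. euclidean) UNIV) (PiE UNIV ?S)"
    by (subst compactin_PiE) auto
  then have c: "compact (PiE UNIV ?S)" by (simp add: euclidean_product_topology)
  have "closed {x :: 'i \<Rightarrow> real. sum x I = 1}"
    by (intro closed_Collect_eq continuous_intros) simp
  moreover have "simplex_on I = PiE UNIV ?S \<inter> {x. sum x I = 1}"
  proof -
    have "x i \<le> 1" if "\<forall>i\<in>I. 0 \<le> x i" "sum x I = 1" "i \<in> I" for x :: "'i \<Rightarrow> real" and i
      using member_le_sum[of i I x] that assms by auto
    then show ?thesis by (auto simp: simplex_on_def PiE_def Pi_def split: if_splits)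
  qed
  ultimately show ?thesis using c by (simp add: compact_Int_closed)
qed

lemma continuous_on_turan_poly: "continuous_on S (turan_poly p a b I)"
  unfolding turan_poly_def case_prod_unfold
  by (intro continuous_intros) (auto intro: continuous_on_subset[OF continuous_on_product_coordinates])

lemma part_pairs_empty:
  assumes "finite I" "card I < a + b"
  shows "part_pairs a b I = {}"
proof safe
  fix A B assume "(A, B) \<in> part_pairs a b I"
  then have *: "A \<union> B \<subseteq> I" "A \<inter> B = {}" "card A = a" "card B = b" unfolding part_pairs_def by blast+
  then have "finite A" "finite B" using assms by (auto intro: finite_subset)
  then have "a + b = card (A \<union> B)" using * by (simp add: card_Un_disjoint)
  also have "\<dots> \<le> card I" using card_mono[OF _ *(1)] assms by simp
  finally show "(A, B) \<in> {}" using assms by simp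
qed

text \<open>
  If a maximiser had two different positive weights, convexity would make merging them lossless, so
  the merged weights would be a maximiser with fewer positive weights, and by induction all of these
  are equal. A third positive weight \<open>x k\<close> then equals \<open>x i + x j\<close>, and merging \<open>i\<close> with \<open>k\<close>
  instead forces \<open>x j = x i + x k\<close>, which is impossible. Without a third positive weight, merging leaves
  a single part, where the polynomial vanishes as a Turan graph with \<open>a + b \<ge> 2\<close> parts does not fit.
\<close>

lemma turan_poly_maximizer_equal:
  assumes fin: "finite I" and p: "0 < p" and ab: "2 \<le> a + b"
    and x: "x \<in> simplex_on I" and pos: "0 < turan_poly p a b I x"
    and max: "\<And>y. y \<in> simplex_on I \<Longrightarrow> turan_poly p a b I y \<le> turan_poly p a b I x"
    and ij: "i \<in> I" "j \<in> I" "x i \<noteq> 0" "x j \<noteq> 0"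
  shows "x i = x j"
  using x pos max ij
proof (induction "card {i \<in> I. x i \<noteq> 0}" arbitrary: x i j rule: less_induct)
  case less
  have nn: "0 \<le> x k" for k using less.prems(1) by (auto simp: simplex_on_def)
  have merge: "x(i := x i + x j, j := 0) \<in> simplex_on I"
      "turan_poly p a b I (x(i := x i + x j, j := 0)) = turan_poly p a b I x"
    if ij: "i \<in> I" "j \<in> I" "x i \<noteq> 0" "x j \<noteq> 0" "x i \<noteq> x j" for i j
  proof -
    have ne: "i \<noteq> j" using ij by auto
    have xp: "0 < x i" "0 < x j" using nn ij by (simp_all add: order_less_le)
    let ?c = "x i + x j"
    let ?L = "4 * x i * x j / ?c\<^sup>2"
    let ?m = "x(i := ?c, j := 0)" and ?e = "x(i := ?c / 2, j := ?c / 2)"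
    show m: "?m \<in> simplex_on I" using simplex_on_redistribute[OF less.prems(1) fin ij(1,2) ne] xp by auto
    have e: "?e \<in> simplex_on I" using simplex_on_redistribute[OF less.prems(1) fin ij(1,2) ne] xp by auto
    have "0 < (x i - x j)\<^sup>2" using ij(5) by simp
    then have "4 * x i * x j < ?c\<^sup>2" by (simp add: power2_eq_square algebra_simps)
    then have L: "0 < ?L" "?L < 1" using xp by auto
    have "turan_poly p a b I x \<le> (1 - ?L) * turan_poly p a b I ?m + ?L * turan_poly p a b I ?e"
      using turan_poly_merge_equalize[OF fin ij(1,2) ne _ _ p] nn xp by simp
    also have "\<dots> \<le> (1 - ?L) * turan_poly p a b I ?m + ?L * turan_poly p a b I x"
      using less.prems(3)[OF e] L(1) by (intro add_left_mono mult_left_mono) simp_all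
    finally have "(1 - ?L) * turan_poly p a b I x \<le> (1 - ?L) * turan_poly p a b I ?m"
      by (simp add: algebra_simps)
    then have "turan_poly p a b I x \<le> turan_poly p a b I ?m"
      using L by (simp only: mult_le_cancel_left_pos diff_gt_0_iff_gt)
    then show "turan_poly p a b I ?m = turan_poly p a b I x"
      using less.prems(3)[OF m] by simp
  qed
  have IH: "(x(i := x i + x j, j := 0)) k = (x(i := x i + x j, j := 0)) l"
    if ij: "i \<in> I" "j \<in> I" "x i \<noteq> 0" "x j \<noteq> 0" "x i \<noteq> x j"
      and kl: "k \<in> I" "l \<in> I" "(x(i := x i + x j, j := 0)) k \<noteq> 0" "(x(i := x i + x j, j := 0)) l \<noteq> 0"
    for i j k l
  proof (rule less.hyps[OF _ merge(1)[OF ij] _ _ kl])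
    let ?m = "x(i := x i + x j, j := 0)"
    have "{k \<in> I. ?m k \<noteq> 0} \<subset> {k \<in> I. x k \<noteq> 0}"
      using ij by (auto split: if_splits)
    then show "card {k \<in> I. ?m k \<noteq> 0} < card {k \<in> I. x k \<noteq> 0}"
      using fin by (intro psubset_card_mono) auto
    show "0 < turan_poly p a b I ?m" unfolding merge(2)[OF ij] by (rule less.prems(2))
    show "turan_poly p a b I y \<le> turan_poly p a b I ?m" if "y \<in> simplex_on I" for y
      unfolding merge(2)[OF ij] by (rule less.prems(3)[OF that])
  qed
  show ?case
  proof (rule ccontr)
    assume ne: "x i \<noteq> x j"
    then have ij: "i \<noteq> j" by auto
    have xp: "0 < x i" "0 < x j" using nn less.prems(6,7) by (simp_all add: order_less_le)
    let ?m = "x(i := x i + x j, j := 0)"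
    show False
    proof (cases "\<exists>k\<in>I. k \<noteq> i \<and> k \<noteq> j \<and> x k \<noteq> 0")
      case True
      then obtain k where k: "k \<in> I" "k \<noteq> i" "k \<noteq> j" "x k \<noteq> 0" by blast
      have "?m i = ?m k"
        by (rule IH[OF less.prems(4-7) ne less.prems(4) k(1)]) (use k ij xp in simp_all)
      then have xk: "x k = x i + x j" using k ij by simp
      then have ik: "x i \<noteq> x k" using xp by simp
      have "(x(i := x i + x k, k := 0)) i = (x(i := x i + x k, k := 0)) j"
        by (rule IH[OF less.prems(4) k(1) less.prems(6) k(4) ik less.prems(4,5)]) (use k ij xp xk in simp_all)
      then show False using k ij xp xk by simp
    next
      case False
      then have supp: "{k \<in> I. ?m k \<noteq> 0} \<subseteq> {i}" by auto
      have "card {k \<in> I. ?m k \<noteq> 0} \<le> card {i}" by (rule card_mono[OF _ supp]) simp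
      also have "card {i} < a + b" using ab by simp
      finally have "part_pairs a b {k \<in> I. ?m k \<noteq> 0} = {}"
        by (intro part_pairs_empty) (use fin in simp_all)
      then have "turan_poly p a b I ?m = 0"
        by (subst turan_poly_support[OF fin p]) (simp add: turan_poly_def)
      then show False using merge(2)[OF less.prems(4-7) ne] less.prems(2) by simp
    qed
  qed
qed

lemma uniform_value_pos: "0 < a + b \<Longrightarrow> a + b \<le> u \<Longrightarrow> 0 < uniform_value p a b u"
  by (auto simp: uniform_value_def)

lemma turan_poly_maximum:
  assumes fin: "finite I" and p: "0 < p" and ab: "2 \<le> a + b" "a + b \<le> card I"
  obtains u where "a + b \<le> u" "u \<le> card I"
    "\<And>x. x \<in> simplex_on I \<Longrightarrow> turan_poly p a b I x \<le> uniform_value p a b u"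
    "\<And>x. x \<in> simplex_on I \<Longrightarrow> turan_poly p a b I x = uniform_value p a b u \<Longrightarrow>
       a + b \<le> card {i \<in> I. x i \<noteq> 0} \<and>
       uniform_value p a b (card {i \<in> I. x i \<noteq> 0}) = uniform_value p a b u \<and>
       (\<forall>i\<in>I. x i \<noteq> 0 \<longrightarrow> x i = 1 / real (card {i \<in> I. x i \<noteq> 0}))"
proof -
  let ?f = "turan_poly p a b I"
  define bar where "bar i = (if i \<in> I then 1 / real (card I) else 0)" for i
  have cI: "card I > 0" "I \<noteq> {}" using ab by auto
  have bar: "bar \<in> simplex_on I" using cI fin by (auto simp: simplex_on_def bar_def)
  have barv: "?f bar = uniform_value p a b (card I)" by (rule turan_poly_uniform) (auto simp: fin bar_def)
  have "\<exists>x\<in>simplex_on I. \<forall>y\<in>simplex_on I. ?f y \<le> ?f x"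
    by (rule continuous_attains_sup) (use compact_simplex_on[OF fin] bar continuous_on_turan_poly in auto)
  then obtain x where x: "x \<in> simplex_on I" and max: "\<And>y. y \<in> simplex_on I \<Longrightarrow> ?f y \<le> ?f x" by blast
  have pos: "0 < ?f x"
    using max[OF bar] uniform_value_pos[of a b "card I" p] ab barv by linarith
  have shape: "a + b \<le> card {i \<in> I. y i \<noteq> 0} \<and> uniform_value p a b (card {i \<in> I. y i \<noteq> 0}) = ?f y \<and>
       (\<forall>i\<in>I. y i \<noteq> 0 \<longrightarrow> y i = 1 / real (card {i \<in> I. y i \<noteq> 0}))"
    if y: "y \<in> simplex_on I" "?f y = ?f x" for y
  proof -
    let ?U = "{i \<in> I. y i \<noteq> 0}"
    have eq: "y i = y j" if "i \<in> ?U" "j \<in> ?U" for i j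
      using turan_poly_maximizer_equal[OF fin p ab(1) y(1), of i j] pos max y(2) that by simp
    have card: "a + b \<le> card ?U"
    proof (rule ccontr)
      assume "\<not> a + b \<le> card ?U"
      then have "?f y = 0" using fin
        by (subst turan_poly_support[OF fin p]) (simp add: turan_poly_def part_pairs_empty)
      with pos y show False by simp
    qed
    have "sum y ?U = sum y I" using fin by (intro sum.mono_neutral_left) auto
    then have s1: "sum y ?U = 1" using y by (simp add: simplex_on_def)
    have val: "y i = 1 / real (card ?U)" if "i \<in> ?U" for i
    proof -
      have "sum y ?U = sum (\<lambda>_. y i) ?U" using eq that by (intro sum.cong) auto
      then show ?thesis using s1 card ab by (simp add: field_simps)
    qed
    have "?f y = turan_poly p a b ?U y" by (rule turan_poly_support[OF fin p])
    also have "\<dots> = uniform_value p a b (card ?U)"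
    proof (rule turan_poly_uniform)
      show "finite ?U" using fin by simp
    qed (rule val)
    finally have "uniform_value p a b (card ?U) = ?f y" by (rule sym)
    with card val show ?thesis by blast
  qed
  let ?u = "card {i \<in> I. x i \<noteq> 0}"
  show thesis
  proof (rule that[of ?u])
    show "?u \<le> card I" using fin by (intro card_mono) auto
    show "a + b \<le> ?u" using shape[OF x] by simp
    show "?f y \<le> uniform_value p a b ?u" if "y \<in> simplex_on I" for y
      using max[OF that] shape[OF x] by simp
    show "a + b \<le> card {i \<in> I. y i \<noteq> 0} \<and>
       uniform_value p a b (card {i \<in> I. y i \<noteq> 0}) = uniform_value p a b ?u \<and>
       (\<forall>i\<in>I. y i \<noteq> 0 \<longrightarrow> y i = 1 / real (card {i \<in> I. y i \<noteq> 0}))"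
      if "y \<in> simplex_on I" "?f y = uniform_value p a b ?u" for y
      using shape[OF x] shape[of y] that by simp
  qed
qed

lemma uniform_value_eq:
  assumes "a + b \<le> u"
  shows "uniform_value p a b u = fact u / (fact a * fact b * fact (u - (a + b)) * real u ^ (p * (a + b) + b))"
proof -
  have "real (u choose a) = fact u / (fact a * fact (u - a))" using assms by (simp add: binomial_fact)
  moreover have "real ((u - a) choose b) = fact (u - a) / (fact b * fact (u - a - b))"
    using assms by (simp add: binomial_fact)
  ultimately show ?thesis by (simp add: uniform_value_def)
qed

text \<open>
  The ratio of two consecutive uniform values is the quantity that defines the optimal number of parts.
\<close>

lemma uniform_value_step:
  assumes "0 < a + b" "a + b < u"
  shows "uniform_value p a b u =
    real u / (real u - real (a + b)) * (1 - 1 / real u) ^ (p * (a + b) + b) * uniform_value p a b (u - 1)"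
proof -
  obtain v where v: "u = Suc v" using assms by (cases u) auto
  obtain w where w: "v = (a + b) + w" using assms v by (metis less_Suc_eq_le le_Suc_ex)
  let ?s = "p * (a + b) + b"
  have "0 < v" using assms(1) w by linarith
  then have v0: "real v > 0" by simp
  have "uniform_value p a b u = real u * fact v / (fact a * fact b * (real (Suc w) * fact w) * real u ^ ?s)"
    using v w by (subst uniform_value_eq) (simp_all add: Suc_diff_le)
  moreover have "uniform_value p a b (u - 1) = fact v / (fact a * fact b * fact w * real v ^ ?s)"
    using v w by (subst uniform_value_eq) simp_all
  moreover have "(1 - 1 / real u) ^ ?s = real v ^ ?s / real u ^ ?s"
    using v by (simp add: field_simps flip: power_divide)
  moreover have "real u - real (a + b) = real (Suc w)" using v w by simp
  moreover have "real v ^ ?s > 0" using v0 by (rule zero_less_power)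
  ultimately show ?thesis by (simp del: of_nat_Suc of_nat_power)
qed

section \<open>The optimal number of parts\<close>

abbreviation (input) growth_ratio :: "nat \<Rightarrow> nat \<Rightarrow> nat \<Rightarrow> real" where
  "growth_ratio r s u \<equiv> real u / (real u - real r) * (1 - 1 / real u) ^ s"

lemma growth_ratio_gt_1_iff:
  assumes "r < u"
  shows "growth_ratio r s u > 1 \<longleftrightarrow> 1 - real r * (1 / real u) < (1 - 1 / real u) ^ s"
proof -
  have pos: "real u / (real u - real r) > 0" using assms by simp
  have "1 - real r * (1 / real u) = 1 / (real u / (real u - real r))"
    using assms by (simp add: diff_divide_distrib)
  then show ?thesis by (simp only: pos_divide_less_eq[OF pos] mult.commute)
qed

text \<open>
  Convexity of \<open>z \<mapsto> (1 - z) ^ s\<close>: the value at \<open>v\<close> lies below the chord from \<open>0\<close> to \<open>w\<close>.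
\<close>

lemma convex_one_minus_power:
  fixes v w :: real
  assumes "0 < v" "v \<le> w" "w \<le> 1"
  shows "(1 - v) ^ s \<le> (1 - v / w) + (v / w) * (1 - w) ^ s"
proof (induction s)
  case (Suc s)
  have vw: "0 \<le> 1 - v" "0 \<le> v / w" "v / w \<le> 1" using assms by auto
  have p: "0 \<le> (1 - w) ^ s" "(1 - w) ^ s \<le> 1" using assms by (auto simp: power_le_one)
  have "(1 - v) ^ Suc s \<le> (1 - v) * ((1 - v / w) + (v / w) * (1 - w) ^ s)"
    using mult_left_mono[OF Suc vw(1)] by simp
  also have "\<dots> = (1 - v / w) + (v / w) * (1 - w) ^ Suc s - (w - v) * (v / w) * (1 - (1 - w) ^ s)"
    using assms by (simp add: field_simps)
  also have "\<dots> \<le> (1 - v / w) + (v / w) * (1 - w) ^ Suc s"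
    using assms vw p by simp
  finally show ?case .
qed (use assms in auto)

text \<open>
  With \<open>z = 1 / u\<close> the ratio exceeds \<open>1\<close> iff the convex function \<open>(1 - z) ^ s\<close> exceeds the linear
  function \<open>1 - r * z\<close>. They agree at \<open>z = 0\<close>, so once the convex function is above it stays above
  as \<open>z\<close> grows, that is, as \<open>u\<close> decreases.
\<close>

lemma growth_ratio_gt_1_downward:
  assumes "r < v" "v \<le> u" "growth_ratio r s u > 1"
  shows "growth_ratio r s v > 1"
proof -
  have ru: "r < u" using assms by simp
  let ?x = "1 / real u" and ?y = "1 / real v"
  have xy: "0 < ?x" "?x \<le> ?y" "?y \<le> 1" using assms by (auto simp: field_simps)
  have "1 - real r * ?x < (1 - ?x) ^ s" using assms growth_ratio_gt_1_iff[OF ru] by simp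
  also have "\<dots> \<le> (1 - ?x / ?y) + (?x / ?y) * (1 - ?y) ^ s" by (rule convex_one_minus_power[OF xy])
  finally have "?x / ?y * (1 - real r * ?y) < ?x / ?y * (1 - ?y) ^ s"
    using xy assms(1) by (simp add: right_diff_distrib)
  moreover have "0 < ?x / ?y" using assms(1,2) by simp
  ultimately have "1 - real r * ?y < (1 - ?y) ^ s" by (simp only: mult_less_cancel_left_pos)
  then show ?thesis using growth_ratio_gt_1_iff[OF assms(1)] by simp
qed

text \<open>
  At \<open>z = 0\<close> the function \<open>(1 - z) ^ s\<close> has slope \<open>- s < - r\<close>, so it lies below \<open>1 - r * z\<close> for small
  \<open>z\<close>. Quantitatively, \<open>(1 - z) ^ s \<le> 1 / (1 + s * z)\<close> by Bernoulli, and \<open>u \<ge> r * s\<close> suffices. This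
  bound makes the greatest \<open>u\<close> with ratio above \<open>1\<close> well defined.
\<close>

lemma growth_ratio_le_1:
  assumes "0 < r" "r < s" "r * s \<le> u"
  shows "\<not> growth_ratio r s u > 1"
proof -
  have "r * 1 < r * s" using assms by (intro mult_strict_left_mono) auto
  then have ru: "r < u" using assms by linarith
  let ?v = "1 / real u"
  have v: "0 < ?v" "?v \<le> 1" "real r * ?v < 1" using ru by auto
  have "(1 - ?v) ^ s * (1 + real s * ?v) \<le> (1 - ?v) ^ s * (1 + ?v) ^ s"
    using v by (intro mult_left_mono Bernoulli_inequality order.trans[OF _ less_imp_le[OF v(1)]]) auto
  also have "\<dots> = (1 - ?v\<^sup>2) ^ s" by (simp add: algebra_simps power2_eq_square flip: power_mult_distrib)
  also have "\<dots> \<le> 1" using v by (intro power_le_one) (auto simp: power_le_one)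
  also have "1 \<le> (1 - real r * ?v) * (1 + real s * ?v)"
  proof -
    have "real (r * s) * ?v \<le> 1"
    proof -
      have "real (r * s) \<le> real u" using assms(3) by (rule of_nat_mono)
      then show ?thesis using ru by (simp add: field_simps)
    qed
    also have "1 \<le> real s - real r" using assms(2) by simp
    finally have "0 \<le> ?v * (real s - real r - real (r * s) * ?v)" using v by simp
    also have "\<dots> = (1 - real r * ?v) * (1 + real s * ?v) - 1" by (simp add: algebra_simps)
    finally show ?thesis by simp
  qed
  finally have "(1 - ?v) ^ s \<le> 1 - real r * ?v"
    using v by (subst (asm) mult_le_cancel_right_pos) (auto intro: add_pos_nonneg)
  then show ?thesis using growth_ratio_gt_1_iff[OF ru] by simp
qed

text \<open>
  Equality would mean \<open>(u - 1) ^ s = (u - r) * u ^ (s - 1)\<close>, so that \<open>u\<close> divides \<open>(u - 1) ^ s\<close>,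
  although \<open>u > 1\<close> is coprime to \<open>u - 1\<close>. This is why two consecutive numbers of parts are never tied
  and the optimum is unique.
\<close>

lemma growth_ratio_ne_1:
  assumes "0 < r" "r < u" "1 < s"
  shows "growth_ratio r s u \<noteq> 1"
proof
  assume eq: "growth_ratio r s u = 1"
  have "1 - 1 / real u = (real u - 1) / real u" using assms by (simp add: field_simps)
  then have "growth_ratio r s u = real u * (real u - 1) ^ s / ((real u - real r) * real u ^ s)"
    by (simp add: power_divide)
  with eq assms have "real u * (real u - 1) ^ s = (real u - real r) * real u ^ s" by (simp add: field_simps)
  then have "real (u * (u - 1) ^ s) = real ((u - r) * u ^ s)" using assms by (simp add: of_nat_diff)
  then have "u * (u - 1) ^ s = (u - r) * u ^ s" by (rule of_nat_eq_iff[THEN iffD1])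
  moreover obtain s' where s: "s = Suc s'" "0 < s'" using assms(3) by (cases s) auto
  ultimately have *: "(u - 1) ^ s = (u - r) * u ^ s'" using assms by simp
  obtain w where w: "u = Suc w" using assms by (cases u) auto
  have cop: "coprime u ((u - 1) ^ s)" unfolding w using coprime_Suc_left_nat by simp
  show False
  proof (cases s')
    case 0
    then show False using * s assms by simp
  next
    case (Suc s'')
    then have "u dvd (u - 1) ^ s" using * by simp
    with cop have "u = 1" by (metis coprime_absorb_left nat_dvd_1_iff_1)
    with assms show False by simp
  qed
qed


text \<open>
  The target has \<open>a\<close> parts of size \<open>p\<close> and \<open>b\<close> parts of size \<open>p + 1\<close>, hence \<open>r = a + b\<close> and
  \<open>s = p * (a + b) + b\<close>; the third assumption says that it is not a complete graph, \<open>r < s\<close>. The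
  number \<open>t\<close> is where the uniform values stop growing.
\<close>

locale turning_point =
  fixes p a b t :: nat
  assumes p: "0 < p" and ab: "2 \<le> a + b" and big: "2 \<le> p \<or> 0 < b"
    and t: "t = (GREATEST u. a + b \<le> u \<and> (u = a + b \<or> growth_ratio (a + b) (p * (a + b) + b) u > 1))"
begin

lemma two_parts_positive: "0 < a + b"
  using ab by arith

lemma growth_ratio_sign:
  shows turning_point_ge: "a + b \<le> t"
    and turning_point_below: "a + b < u \<Longrightarrow> u \<le> t \<Longrightarrow> growth_ratio (a + b) (p * (a + b) + b) u > 1"
    and turning_point_above: "t < u \<Longrightarrow> growth_ratio (a + b) (p * (a + b) + b) u < 1"
proof -
  let ?r = "a + b" let ?s = "p * ?r + b"
  let ?P = "\<lambda>u. ?r \<le> u \<and> (u = ?r \<or> growth_ratio ?r ?s u > 1)"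
  have rs: "?r < ?s"
  proof (cases "2 \<le> p")
    case True
    have "?r < 2 * ?r" using ab by arith
    also have "\<dots> \<le> p * ?r" using True by (rule mult_right_mono) simp
    also have "\<dots> \<le> ?s" by simp
    finally show ?thesis .
  next
    case False
    then have "p = 1" "0 < b" using big p by auto
    then show ?thesis by simp
  qed
  have bound: "u \<le> ?r * ?s" if "?P u" for u
  proof (cases "u = ?r")
    case True
    then show ?thesis using rs by simp
  next
    case False
    then show ?thesis using that growth_ratio_le_1[of ?r ?s u] rs ab by linarith
  qed
  have Pt: "?P t" unfolding t by (rule GreatestI_nat[of ?P ?r "?r * ?s"]) (use bound in auto)
  then show ge: "?r \<le> t" by simp
  show "growth_ratio ?r ?s u > 1" if "?r < u" "u \<le> t"
    using growth_ratio_gt_1_downward[OF that, of ?s] Pt that by auto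
  show "growth_ratio ?r ?s u < 1" if "t < u"
  proof -
    have "\<not> ?P u" using Greatest_le_nat[of ?P u "?r * ?s"] bound that unfolding t by fastforce
    moreover have "growth_ratio ?r ?s u \<noteq> 1"
      using growth_ratio_ne_1[of ?r u ?s] that ge ab rs by linarith
    ultimately show ?thesis using that ge by fastforce
  qed
qed

lemma uniform_value_increasing:
  assumes "a + b \<le> u" "u < v" "v \<le> t"
  shows "uniform_value p a b u < uniform_value p a b v"
proof -
  have step: "uniform_value p a b w < uniform_value p a b (Suc w)" if "a + b \<le> w" "w < t" for w
  proof -
    have "0 < uniform_value p a b w" using that ab by (intro uniform_value_pos) auto
    moreover have step: "uniform_value p a b (Suc w) =
        growth_ratio (a + b) (p * (a + b) + b) (Suc w) * uniform_value p a b w"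
      by (subst uniform_value_step) (use that two_parts_positive in simp_all)
    moreover have "growth_ratio (a + b) (p * (a + b) + b) (Suc w) > 1"
      using that by (intro turning_point_below) auto
    ultimately show ?thesis
      unfolding step using mult_strict_right_mono[where c = "uniform_value p a b w"] by (metis mult_1)
  qed
  from assms(2,3) show ?thesis
  proof (induction v)
    case (Suc v)
    then show ?case using step[of v] assms(1) by (cases "u = v") auto
  qed simp
qed

lemma uniform_value_decreasing:
  assumes "t \<le> u" "u < v"
  shows "uniform_value p a b v < uniform_value p a b u"
proof -
  have step: "uniform_value p a b (Suc w) < uniform_value p a b w" if "t \<le> w" for w
  proof -
    have "a + b \<le> w" using that turning_point_ge by simp
    then have "0 < uniform_value p a b w" using ab by (intro uniform_value_pos) auto
    moreover have step: "uniform_value p a b (Suc w) =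
        growth_ratio (a + b) (p * (a + b) + b) (Suc w) * uniform_value p a b w"
      by (subst uniform_value_step) (use \<open>a + b \<le> w\<close> two_parts_positive in simp_all)
    moreover have "growth_ratio (a + b) (p * (a + b) + b) (Suc w) < 1"
      using that by (intro turning_point_above) auto
    ultimately show ?thesis
      unfolding step using mult_strict_right_mono[where c = "uniform_value p a b w"] by (metis mult_1)
  qed
  from assms(2) show ?thesis
  proof (induction v)
    case (Suc v)
    then show ?case using step[of v] assms(1) by (cases "u = v") auto
  qed simp
qed

lemma uniform_value_le:
  assumes "a + b \<le> u" "u \<le> m"
  shows "uniform_value p a b u \<le> uniform_value p a b (min m t)"
    and "uniform_value p a b u = uniform_value p a b (min m t) \<Longrightarrow> u = min m t"
proof -
  have "u = min m t \<or> uniform_value p a b u < uniform_value p a b (min m t)"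
  proof (cases "u \<le> t")
    case True
    with assms(2) have "u \<le> min m t" by simp
    then show ?thesis using uniform_value_increasing[OF assms(1), of "min m t"] by fastforce
  next
    case False
    then show ?thesis using uniform_value_decreasing[of t u] assms by (auto simp: min_def)
  qed
  then show "uniform_value p a b u \<le> uniform_value p a b (min m t)"
    "uniform_value p a b u = uniform_value p a b (min m t) \<Longrightarrow> u = min m t" by auto
qed

text \<open>
  Combine the two steps: maximisers are uniform on some number \<open>u\<close> of parts, and among the admissible
  \<open>u\<close> the one closest to \<open>t\<close> wins strictly.
\<close>

theorem turan_poly_le_uniform_value:
  assumes "finite I" "a + b \<le> card I" "x \<in> simplex_on I"
  shows "turan_poly p a b I x \<le> uniform_value p a b (min (card I) t)"
    and "turan_poly p a b I x = uniform_value p a b (min (card I) t) \<Longrightarrow>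
      card {i \<in> I. x i \<noteq> 0} = min (card I) t \<and> (\<forall>i\<in>I. x i \<noteq> 0 \<longrightarrow> x i = 1 / real (min (card I) t))"
proof -
  let ?v = "uniform_value p a b (min (card I) t)"
  obtain u where u: "a + b \<le> u" "u \<le> card I"
    "\<And>x. x \<in> simplex_on I \<Longrightarrow> turan_poly p a b I x \<le> uniform_value p a b u"
    "\<And>x. x \<in> simplex_on I \<Longrightarrow> turan_poly p a b I x = uniform_value p a b u \<Longrightarrow>
       a + b \<le> card {i \<in> I. x i \<noteq> 0} \<and>
       uniform_value p a b (card {i \<in> I. x i \<noteq> 0}) = uniform_value p a b u \<and>
       (\<forall>i\<in>I. x i \<noteq> 0 \<longrightarrow> x i = 1 / real (card {i \<in> I. x i \<noteq> 0}))"
    by (rule turan_poly_maximum[OF assms(1) p ab assms(2)]) (rule that; assumption)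
  have le: "uniform_value p a b u \<le> ?v" by (rule uniform_value_le[OF u(1,2)])
  then show "turan_poly p a b I x \<le> ?v" using u(3)[OF assms(3)] by simp
  assume eq: "turan_poly p a b I x = ?v"
  then have *: "turan_poly p a b I x = uniform_value p a b u" using le u(3)[OF assms(3)] by simp
  let ?U = "{i \<in> I. x i \<noteq> 0}"
  have c: "card ?U = min (card I) t"
  proof (rule uniform_value_le(2))
    show "a + b \<le> card ?U" using u(4)[OF assms(3) *] by simp
    show "card ?U \<le> card I" using assms(1) by (intro card_mono) auto
    show "uniform_value p a b (card ?U) = ?v" using u(4)[OF assms(3) *] * eq by simp
  qed
  have "\<forall>i\<in>I. x i \<noteq> 0 \<longrightarrow> x i = 1 / real (card ?U)" using u(4)[OF assms(3) *] by blast
  with c show "card ?U = min (card I) t \<and> (\<forall>i\<in>I. x i \<noteq> 0 \<longrightarrow> x i = 1 / real (min (card I) t))"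
    unfolding c by blast
qed
end

section \<open>Complete multipartite graphs given by labels\<close>

text \<open>
  The complete multipartite graph whose parts are the fibres of \<open>d\<close>.
\<close>

definition label_graph :: "'a set \<Rightarrow> ('a \<Rightarrow> 'i) \<Rightarrow> 'a sgraph" where
  "label_graph V d = (V, {{u, v} | u v. u \<in> V \<and> v \<in> V \<and> d u \<noteq> d v})"

text \<open>
  As a function of \<open>n\<close> this determines a complete multipartite graph up to isomorphism. Labels that
  do not occur would be parts of size zero and are left out.
\<close>

definition class_count :: "'a set \<Rightarrow> ('a \<Rightarrow> 'i) \<Rightarrow> nat \<Rightarrow> nat" where
  "class_count V d n = card {i \<in> d ` V. card {v \<in> V. d v = i} = n}"

lemma verts_label_graph [simp]: "verts (label_graph V d) = V"
  by (simp add: label_graph_def)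

lemma edge_label_graph_iff:
  assumes "u \<in> V" "v \<in> V"
  shows "{u, v} \<in> edges (label_graph V d) \<longleftrightarrow> d u \<noteq> d v"
  using assms by (auto simp: label_graph_def doubleton_eq_iff)

text \<open>
  Glue bijections between corresponding fibres. It is applied twice below: first to match parts of the
  same size, then to match the vertices inside corresponding parts.
\<close>

lemma bij_betw_of_fibre_cards:
  assumes "finite X" "finite Y" "\<And>k. card {x \<in> X. f x = k} = card {y \<in> Y. g y = k}"
  obtains h where "bij_betw h X Y" "\<And>x. x \<in> X \<Longrightarrow> g (h x) = f x"
proof -
  have "\<exists>h. bij_betw h {x \<in> X. f x = k} {y \<in> Y. g y = k}" for k
    using assms by (intro finite_same_card_bij) auto
  then obtain H where H: "\<And>k. bij_betw (H k) {x \<in> X. f x = k} {y \<in> Y. g y = k}" by metis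
  define h where "h x = H (f x) x" for x
  have hY: "h x \<in> Y \<and> g (h x) = f x" if "x \<in> X" for x
    using bij_betw_apply[OF H[of "f x"], of x] that by (auto simp: h_def)
  have "inj_on h X"
  proof (rule inj_onI)
    fix x x' assume x: "x \<in> X" "x' \<in> X" "h x = h x'"
    then have "f x = f x'" using hY by metis
    then show "x = x'" using x H[of "f x"] by (auto simp: h_def bij_betw_def inj_on_def)
  qed
  moreover have "h ` X = Y"
  proof
    show "h ` X \<subseteq> Y" using hY by blast
    show "Y \<subseteq> h ` X"
    proof
      fix y assume "y \<in> Y"
      then have "y \<in> H (g y) ` {x \<in> X. f x = g y}" using H[of "g y"] by (auto simp: bij_betw_def)
      then obtain x where "x \<in> X" "f x = g y" "y = H (g y) x" by blast
      then have "y = h x" by (simp add: h_def)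
      with \<open>x \<in> X\<close> show "y \<in> h ` X" by blast
    qed
  qed
  ultimately show thesis using that hY by (auto simp: bij_betw_def)
qed

text \<open>
  Being in the same part means being equal or nonadjacent, so an isomorphism permutes the parts;
  conversely, parts of equal sizes can be matched.
\<close>

lemma isomorphic_label_graph_iff:
  assumes fin: "finite V" "finite V'"
  shows "isomorphic (label_graph V d) (label_graph V' d') \<longleftrightarrow> class_count V d = class_count V' d'"
proof
  assume "isomorphic (label_graph V d) (label_graph V' d')"
  then obtain f where f: "bij_betw f V V'"
    and "\<forall>u\<in>V. \<forall>v\<in>V. {u, v} \<in> edges (label_graph V d) \<longleftrightarrow> {f u, f v} \<in> edges (label_graph V' d')"
    by (auto simp: isomorphic_def)
  moreover have fV: "f u \<in> V'" if "u \<in> V" for u using f that by (rule bij_betw_apply)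
  ultimately have iff: "d u = d v \<longleftrightarrow> d' (f u) = d' (f v)" if "u \<in> V" "v \<in> V" for u v
    using that by (simp add: edge_label_graph_iff)
  define g where "g i = d' (f (inv_into V d i))" for i
  have g: "g (d u) = d' (f u)" if "u \<in> V" for u
    using iff[of u "inv_into V d (d u)"] that by (simp add: g_def inv_into_into f_inv_into_f)
  have inj: "inj_on g (d ` V)" using g iff by (auto simp: inj_on_def)
  have im: "g ` d ` V = d' ` V'"
  proof -
    have "g ` d ` V = d' ` f ` V" using g by (auto simp: image_image intro!: image_cong)
    also have "f ` V = V'" using f by (simp add: bij_betw_def)
    finally show ?thesis .
  qed
  have size: "card {v \<in> V'. d' v = g i} = card {u \<in> V. d u = i}" if "i \<in> d ` V" for i
  proof -
    from that obtain w where w: "w \<in> V" "i = d w" by blast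
    have "bij_betw f {u \<in> V. d u = i} {v \<in> V'. d' v = g i}"
    proof (rule bij_betw_subset[OF f])
      show "f ` {u \<in> V. d u = i} = {v \<in> V'. d' v = g i}"
      proof safe
        fix v assume "v \<in> V'" "d' v = g i"
        moreover then obtain u where "u \<in> V" "v = f u" using f by (auto simp: bij_betw_def)
        ultimately show "v \<in> f ` {u \<in> V. d u = i}" using w g[of w] iff[of u w] by auto
      qed (use fV g in auto)
    qed auto
    then show ?thesis by (simp add: bij_betw_same_card)
  qed
  show "class_count V d = class_count V' d'"
  proof
    fix n
    have "g ` {i \<in> d ` V. card {u \<in> V. d u = i} = n} = {i \<in> d' ` V'. card {v \<in> V'. d' v = i} = n}"
      unfolding im[symmetric] using size by auto
    then show "class_count V d n = class_count V' d' n"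
      unfolding class_count_def using card_image[OF inj_on_subset[OF inj, of "{i \<in> d ` V. card {u \<in> V. d u = i} = n}"]]
      by auto
  qed
next
  assume eq: "class_count V d = class_count V' d'"
  have "card {i \<in> d ` V. card {v \<in> V. d v = i} = n} = card {i \<in> d' ` V'. card {v \<in> V'. d' v = i} = n}" for n
    using fun_cong[OF eq, of n] by (simp add: class_count_def)
  then obtain g where g: "bij_betw g (d ` V) (d' ` V')"
      "\<And>i. i \<in> d ` V \<Longrightarrow> card {v \<in> V'. d' v = g i} = card {v \<in> V. d v = i}"
    using bij_betw_of_fibre_cards[of "d ` V" "d' ` V'" "\<lambda>i. card {v \<in> V. d v = i}" "\<lambda>i. card {v \<in> V'. d' v = i}"] fin
    by auto
  have "card {v \<in> V. g (d v) = k} = card {v \<in> V'. d' v = k}" for k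
  proof (cases "k \<in> d' ` V'")
    case True
    then have "k \<in> g ` (d ` V)" using g(1) by (simp add: bij_betw_def)
    then obtain i where i: "i \<in> d ` V" "k = g i" by blast
    then have "{v \<in> V. g (d v) = k} = {v \<in> V. d v = i}"
      using g(1) by (auto simp: bij_betw_def inj_on_def)
    then show ?thesis using g(2) i by simp
  next
    case False
    then have "{v \<in> V. g (d v) = k} = {}" "{v \<in> V'. d' v = k} = {}"
      using g(1) by (auto simp: bij_betw_def)
    then show ?thesis by (simp only: card.empty)
  qed
  then obtain f where f: "bij_betw f V V'" "\<And>v. v \<in> V \<Longrightarrow> d' (f v) = g (d v)"
    using bij_betw_of_fibre_cards[of V V' "\<lambda>v. g (d v)" d'] fin by auto
  show "isomorphic (label_graph V d) (label_graph V' d')"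
    unfolding isomorphic_def verts_label_graph
  proof (intro exI conjI ballI)
    show "bij_betw f V V'" by (rule f)
    fix u v assume uv: "u \<in> V" "v \<in> V"
    then have "f u \<in> V'" "f v \<in> V'" using f(1) by (auto dest: bij_betw_apply)
    moreover have "d u = d v \<longleftrightarrow> g (d u) = g (d v)" using g(1) uv by (auto simp: bij_betw_def inj_on_def)
    ultimately show "{u, v} \<in> edges (label_graph V d) \<longleftrightarrow> {f u, f v} \<in> edges (label_graph V' d')"
      using uv f(2) by (simp add: edge_label_graph_iff)
  qed
qed

definition turan_profile :: "nat \<Rightarrow> nat \<Rightarrow> nat \<Rightarrow> nat \<Rightarrow> nat" where
  "turan_profile p a b n = (if n = p then a else if n = Suc p then b else 0)"

lemma sum_class_sizes:
  assumes "finite V" "finite I" "c ` V \<subseteq> I"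
  shows "(\<Sum>i\<in>I. card {v \<in> V. c v = i}) = card V"
  using sum.group[OF assms, of "\<lambda>_. 1::nat"] by simp

text \<open>
  Once the parts of sizes \<open>p\<close> and \<open>p + 1\<close> are there in the right numbers, they use up all vertices,
  so the remaining labels are unused.
\<close>

lemma class_count_eq_turan_profile_iff:
  assumes fin: "finite V" "finite I" and c: "c ` V \<subseteq> I" and p: "0 < p"
    and V: "card V = p * (a + b) + b"
  shows "class_count V c = turan_profile p a b \<longleftrightarrow>
    card {i \<in> I. card {v \<in> V. c v = i} = p} = a \<and> card {i \<in> I. card {v \<in> V. c v = i} = Suc p} = b"
proof -
  let ?N = "\<lambda>i. card {v \<in> V. c v = i}"
  have pos: "i \<in> c ` V" if "0 < ?N i" for i
  proof -
    from that have "{v \<in> V. c v = i} \<noteq> {}" by (metis card.empty less_irrefl)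
    then show ?thesis by blast
  qed
  have cc: "class_count V c n = card {i \<in> I. ?N i = n}" if "0 < n" for n
    unfolding class_count_def using that pos c by (intro arg_cong[of _ _ card]) auto
  show ?thesis
  proof
    assume "class_count V c = turan_profile p a b"
    then show "card {i \<in> I. ?N i = p} = a \<and> card {i \<in> I. ?N i = Suc p} = b"
      using cc[of p] cc[of "Suc p"] p by (simp add: turan_profile_def)
  next
    assume ab: "card {i \<in> I. ?N i = p} = a \<and> card {i \<in> I. ?N i = Suc p} = b"
    let ?A = "{i \<in> I. ?N i = p}" and ?B = "{i \<in> I. ?N i = Suc p}"
    let ?C = "I - (?A \<union> ?B)"
    have "I = (?A \<union> ?B) \<union> ?C" by auto
    then have "sum ?N I = sum ?N ((?A \<union> ?B) \<union> ?C)" by simp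
    also have "\<dots> = sum ?N (?A \<union> ?B) + sum ?N ?C" using fin by (intro sum.union_disjoint) auto
    also have "sum ?N (?A \<union> ?B) = sum ?N ?A + sum ?N ?B" using fin by (intro sum.union_disjoint) auto
    also have "sum ?N ?A = p * a" using ab by simp
    also have "sum ?N ?B = Suc p * b" using ab by simp
    finally have "sum ?N ?C = 0" using sum_class_sizes[OF fin c] V by (simp add: algebra_simps)
    moreover have "finite ?C" using fin(2) by (rule finite_Diff)
    ultimately have "\<forall>i\<in>?C. ?N i = 0" using sum_eq_0_iff[of ?C ?N] by blast
    then have zero: "?N i = 0" if "i \<in> I" "?N i \<noteq> p" "?N i \<noteq> Suc p" for i
      using that by blast
    show "class_count V c = turan_profile p a b"
    proof
      fix n
      show "class_count V c n = turan_profile p a b n"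
      proof (cases "n = p \<or> n = Suc p")
        case True
        then show ?thesis using ab cc[of n] p by (auto simp: turan_profile_def)
      next
        case False
        have "{i \<in> c ` V. ?N i = n} = {}"
        proof safe
          fix v assume v: "v \<in> V" "n = ?N (c v)"
          then have "?N (c v) = 0" using zero[of "c v"] False c by auto
          then show "c v \<in> {}" using v(1) fin by auto
        qed
        then have "class_count V c n = 0" unfolding class_count_def by (simp only: card.empty)
        then show ?thesis using False by (auto simp: turan_profile_def)
      qed
    qed
  qed
qed

text \<open>
  Balanced parts have sizes \<open>m\<close> and \<open>m + 1\<close>, where \<open>m\<close> is the smallest size. As fewer than \<open>r\<close>
  parts have size \<open>m + 1\<close>, division with remainder gives \<open>m = p\<close> and \<open>q\<close> parts of size \<open>p + 1\<close>.
\<close>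

lemma turan_graph_eq_label_graph:
  fixes T :: "'a sgraph"
  assumes T: "is_turan_graph s r T" and s: "s = p * r + q" and q: "q < r" and p: "0 < p"
  obtains c :: "'a \<Rightarrow> nat" where "T = label_graph (verts T) c" "finite (verts T)" "card (verts T) = s"
    "class_count (verts T) c = turan_profile p (r - q) q"
proof -
  let ?V = "verts T"
  from T have fin: "finite ?V" and V: "card ?V = s" by (auto simp: is_turan_graph_def simple_graph_def)
  from T obtain c where c: "c ` ?V \<subseteq> {..<r}"
    and E: "edges T = {{u, v} | u v. u \<in> ?V \<and> v \<in> ?V \<and> c u \<noteq> c v}"
    and bal: "\<And>i j. i < r \<Longrightarrow> j < r \<Longrightarrow> card {v \<in> ?V. c v = i} \<le> card {v \<in> ?V. c v = j} + 1"
    by (auto simp: is_turan_graph_def)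
  let ?N = "\<lambda>i. card {v \<in> ?V. c v = i}"
  have ne: "?N ` {..<r} \<noteq> {}" using q by auto
  define m where "m = Min (?N ` {..<r})"
  obtain i0 where i0: "i0 < r" "?N i0 = m" using Min_in[OF _ ne] by (auto simp: m_def)
  have ge: "m \<le> ?N i" if "i < r" for i using that by (auto simp: m_def)
  have le: "?N i \<le> Suc m" if "i < r" for i using bal[OF that i0(1)] i0(2) by simp
  let ?B = "{i \<in> {..<r}. ?N i = Suc m}" and ?A = "{i \<in> {..<r}. ?N i = m}"
  have "?N i = m \<or> ?N i = Suc m" if "i < r" for i using ge[OF that] le[OF that] by linarith
  then have AB: "{..<r} = ?A \<union> ?B" by blast
  have cA: "card ?A = r - card ?B"
  proof -
    have "card {..<r} = card (?A \<union> ?B)" using AB by (rule arg_cong)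
    also have "\<dots> = card ?A + card ?B" by (rule card_Un_disjoint) auto
    finally show ?thesis by simp
  qed
  have "i0 \<notin> ?B" "i0 \<in> {..<r}" using i0 by simp_all
  then have "?B \<subset> {..<r}" by blast
  then have "card ?B < card {..<r}" by (rule psubset_card_mono[rotated]) simp
  then have B: "card ?B < r" by (simp only: card_lessThan)
  have "s = sum ?N {..<r}" using sum_class_sizes[OF fin _ c] V by simp
  also have "\<dots> = sum ?N (?A \<union> ?B)" using AB by (rule arg_cong)
  also have "\<dots> = sum ?N ?A + sum ?N ?B" by (rule sum.union_disjoint) auto
  also have "\<dots> = m * card ?A + Suc m * card ?B" by simp
  also have "\<dots> = m * (card ?A + card ?B) + card ?B" by (simp add: algebra_simps)
  also have "card ?A + card ?B = r" using B cA by linarith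
  finally have *: "p * r + q = m * r + card ?B" using s by simp
  have "(p * r + q) div r = p" "(p * r + q) mod r = q" using q by auto
  note 1 = this[unfolded *]
  have 2: "(m * r + card ?B) div r = m" "(m * r + card ?B) mod r = card ?B" using B by auto
  have mp: "m = p" by (rule trans[OF 2(1)[symmetric] 1(1)])
  have Bq: "card ?B = q" by (rule trans[OF 2(2)[symmetric] 1(2)])
  have Ap: "card ?A = r - q" using cA Bq by simp
  have rq: "r = (r - q) + q" using q by simp
  show thesis
  proof (rule that)
    show "T = label_graph ?V c" using E by (simp add: label_graph_def prod_eq_iff)
    have "card ?V = p * (r - q + q) + q" using V s rq by simp
    then show "class_count ?V c = turan_profile p (r - q) q"
      using Ap Bq unfolding mp
      by (intro class_count_eq_turan_profile_iff[OF fin _ c p, THEN iffD2]) simp_all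
  qed (use fin V in auto)
qed

section \<open>Counting labellings with prescribed class sizes\<close>

text \<open>
  The multinomial coefficient: labellings of \<open>{..<s}\<close> are words of length \<open>s\<close>, and the prescribed
  class sizes say that the word is an arrangement of a fixed multiset of labels.
\<close>

lemma card_labellings_with_class_sizes:
  assumes I: "finite I" and n: "sum n I = s"
  shows "card {c \<in> {..<s} \<rightarrow>\<^sub>E I. \<forall>i\<in>I. card {j \<in> {..<s}. c j = i} = n i} * (\<Prod>i\<in>I. fact (n i)) = fact s"
proof -
  let ?L = "{c \<in> {..<s} \<rightarrow>\<^sub>E I. \<forall>i\<in>I. card {j \<in> {..<s}. c j = i} = n i}"
  define M where "M = (\<Sum>i\<in>I. replicate_mset (n i) i)"
  have count: "count M i = (if i \<in> I then n i else 0)" for i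
    using I by (simp add: M_def count_sum sum.delta)
  have size: "size M = s" using n by (simp add: M_def size_multiset_sum)
  have fibre: "count (mset xs) i = card {j \<in> {..<length xs}. xs ! j = i}" for xs :: "'a list" and i
    unfolding count_mset count_list_eq_length_filter length_filter_conv_card
    by (rule arg_cong[of _ _ card]) auto
  have "bij_betw (\<lambda>c. map c [0..<s]) ?L (permutations_of_multiset M)"
  proof (rule bij_betwI[where g = "\<lambda>xs. restrict ((!) xs) {..<s}"])
    show "(\<lambda>c. map c [0..<s]) \<in> ?L \<rightarrow> permutations_of_multiset M"
    proof
      fix c assume c: "c \<in> ?L"
      have "mset (map c [0..<s]) = M"
      proof (rule multiset_eqI)
        fix i
        have "count (mset (map c [0..<s])) i = card {j \<in> {..<s}. c j = i}"
          by (subst fibre) (auto intro!: arg_cong[of _ _ card])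
        moreover have "{j \<in> {..<s}. c j = i} = {}" if "i \<notin> I" using c that by auto
        ultimately show "count (mset (map c [0..<s])) i = count M i"
          using c by (auto simp: count)
      qed
      then show "map c [0..<s] \<in> permutations_of_multiset M" by (rule permutations_of_multisetI)
    qed
    show "(\<lambda>xs. restrict ((!) xs) {..<s}) \<in> permutations_of_multiset M \<rightarrow> ?L"
    proof
      fix xs assume "xs \<in> permutations_of_multiset M"
      then have xs: "mset xs = M" by (rule permutations_of_multisetD)
      then have len: "length xs = s" using size by (metis size_mset)
      have "set_mset M \<subseteq> I" using count by (metis count_eq_zero_iff subsetI)
      then have "set xs \<subseteq> I" using xs by (metis set_mset_mset)
      moreover have "card {j \<in> {..<s}. restrict ((!) xs) {..<s} j = i} = n i" if "i \<in> I" for i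
      proof -
        have "{j \<in> {..<s}. restrict ((!) xs) {..<s} j = i} = {j \<in> {..<length xs}. xs ! j = i}"
          using len by auto
        then show ?thesis using fibre[of xs i] xs count[of i] that by simp
      qed
      ultimately show "restrict ((!) xs) {..<s} \<in> ?L" using len by (auto simp: subset_iff)
    qed
    show "restrict ((!) (map c [0..<s])) {..<s} = c" if "c \<in> ?L" for c
      using that by (auto simp: PiE_iff extensional_def fun_eq_iff)
    show "map (restrict ((!) xs) {..<s}) [0..<s] = xs" if "xs \<in> permutations_of_multiset M" for xs
    proof -
      have "length xs = s" using that size by (metis permutations_of_multisetD size_mset)
      then show ?thesis by (intro nth_equalityI) auto
    qed
  qed
  then have "card ?L = card (permutations_of_multiset M)" by (rule bij_betw_same_card)
  moreover have "(\<Prod>i\<in>I. fact (n i)) = (\<Prod>i\<in>set_mset M. fact (count M i) :: nat)"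
  proof (rule prod.mono_neutral_cong_right)
    show "set_mset M \<subseteq> I" using count by (metis count_eq_zero_iff subsetI)
    show "\<forall>i\<in>I - set_mset M. fact (n i) = 1" using count by (metis DiffD1 DiffD2 fact_0 not_in_iff)
    show "fact (n i) = fact (count M i)" if "i \<in> set_mset M" for i
      using that count[of i] by (metis count_eq_zero_iff)
  qed (rule I)
  ultimately show ?thesis
    using card_permutations_of_multiset_aux[of M] size by simp
qed

definition turan_labellings :: "nat \<Rightarrow> nat \<Rightarrow> nat \<Rightarrow> nat \<Rightarrow> 'i set \<Rightarrow> (nat \<Rightarrow> 'i) set" where
  "turan_labellings s p a b I = {c \<in> {..<s} \<rightarrow>\<^sub>E I. class_count {..<s} c = turan_profile p a b}"

text \<open>
  The multinomial coefficient \<open>s! / (p! ^ a * (p + 1)! ^ b)\<close>, where \<open>s = p * (a + b) + b\<close>.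
\<close>

definition turan_constant :: "nat \<Rightarrow> nat \<Rightarrow> nat \<Rightarrow> real" where
  "turan_constant p a b = fact (p * (a + b) + b) / (fact p ^ (a + b) * (real p + 1) ^ b)"

text \<open>
  Group the labellings by the pair \<open>(A, B)\<close> of sets of labels used \<open>p\<close> and \<open>p + 1\<close> times. All
  labellings in a group contribute the same monomial, and every group has the same size.
\<close>

lemma sum_turan_labellings:
  fixes x :: "'i \<Rightarrow> real"
  assumes I: "finite I" and p: "0 < p" and s: "s = p * (a + b) + b"
  shows "(\<Sum>c\<in>turan_labellings s p a b I. \<Prod>j<s. x (c j)) = turan_constant p a b * turan_poly p a b I x"
proof -
  let ?N = "\<lambda>c i. card {j \<in> {..<s}. c j = i}"
  let ?pair = "\<lambda>c. ({i \<in> I. ?N c i = p}, {i \<in> I. ?N c i = Suc p})"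
  let ?G = "turan_labellings s p a b I"
  have G: "?G = {c \<in> {..<s} \<rightarrow>\<^sub>E I. ?pair c \<in> part_pairs a b I}"
  proof -
    have "class_count {..<s} c = turan_profile p a b \<longleftrightarrow> ?pair c \<in> part_pairs a b I"
      if "c \<in> {..<s} \<rightarrow>\<^sub>E I" for c
    proof -
      have "c ` {..<s} \<subseteq> I" using that by auto
      then show ?thesis
        by (subst class_count_eq_turan_profile_iff[OF _ I _ p]) (auto simp: s part_pairs_def)
    qed
    then show ?thesis by (auto simp: turan_labellings_def)
  qed
  have "finite ({..<s} \<rightarrow>\<^sub>E I)" using I by (intro finite_PiE) auto
  then have finG: "finite ?G" by (rule rev_finite_subset) (auto simp: G)
  have "(\<Sum>c\<in>?G. \<Prod>j<s. x (c j)) = (\<Sum>AB\<in>part_pairs a b I. \<Sum>c\<in>{c \<in> ?G. ?pair c = AB}. \<Prod>j<s. x (c j))"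
    by (rule sum.group[symmetric]) (use finG I G in auto)
  also have "\<dots> = (\<Sum>(A, B)\<in>part_pairs a b I. turan_constant p a b * ((\<Prod>i\<in>A. x i ^ p) * (\<Prod>i\<in>B. x i ^ Suc p)))"
  proof (rule sum.cong[OF refl], clarify)
    fix A B assume AB: "(A, B) \<in> part_pairs a b I"
    then have sub: "A \<subseteq> I" "B \<subseteq> I" "A \<inter> B = {}" "card A = a" "card B = b" by (auto simp: part_pairs_def)
    define n where "n i = (if i \<in> A then p else if i \<in> B then Suc p else 0)" for i
    have finAB: "finite A" "finite B" using sub I by (auto intro: finite_subset)
    have split: "(\<Prod>i\<in>I. f (n i) i) = (\<Prod>i\<in>A. f p i) * (\<Prod>i\<in>B. f (Suc p) i)"
      if "\<And>i. f 0 i = 1" for f :: "nat \<Rightarrow> 'i \<Rightarrow> real"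
    proof -
      have "(\<Prod>i\<in>I. f (n i) i) = (\<Prod>i\<in>A \<union> B. f (n i) i)"
        using sub that I by (intro prod.mono_neutral_right) (auto simp: n_def)
      also have "\<dots> = (\<Prod>i\<in>A. f (n i) i) * (\<Prod>i\<in>B. f (n i) i)"
        using sub finAB by (intro prod.union_disjoint) auto
      also have "(\<Prod>i\<in>A. f (n i) i) = (\<Prod>i\<in>A. f p i)" by (intro prod.cong) (auto simp: n_def)
      also have "(\<Prod>i\<in>B. f (n i) i) = (\<Prod>i\<in>B. f (Suc p) i)" using sub by (intro prod.cong) (auto simp: n_def)
      finally show ?thesis .
    qed
    have sumn: "sum n I = s"
    proof -
      have "sum n I = sum n (A \<union> B)" using sub I by (intro sum.mono_neutral_right) (auto simp: n_def)
      also have "\<dots> = sum n A + sum n B" using sub finAB by (intro sum.union_disjoint) auto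
      also have "sum n A = (\<Sum>i\<in>A. p)" by (intro sum.cong) (auto simp: n_def)
      also have "sum n B = (\<Sum>i\<in>B. Suc p)" using sub by (intro sum.cong) (auto simp: n_def)
      finally show ?thesis using sub s by (simp add: algebra_simps)
    qed
    let ?L = "{c \<in> {..<s} \<rightarrow>\<^sub>E I. \<forall>i\<in>I. ?N c i = n i}"
    have fibre: "{c \<in> ?G. ?pair c = (A, B)} = ?L"
    proof (rule Collect_cong, rule iffI; (elim conjE)?)
      fix c assume c: "c \<in> ?G" "?pair c = (A, B)"
      then have cI: "c \<in> {..<s} \<rightarrow>\<^sub>E I" by (simp add: G)
      then have "c ` {..<s} \<subseteq> I" by auto
      then have tot: "sum (?N c) I = s" using sum_class_sizes[of "{..<s}" I c] I by simp
      have le: "n i \<le> ?N c i" for i using c(2) by (auto simp: n_def)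
      have "\<forall>i\<in>I. ?N c i = n i"
      proof (rule ccontr)
        assume "\<not> (\<forall>i\<in>I. ?N c i = n i)"
        then obtain i where "i \<in> I" "n i < ?N c i" using le by (metis le_neq_implies_less)
        then have "sum n I < sum (?N c) I" using I le by (intro sum_strict_mono_ex1) auto
        then show False using sumn tot by simp
      qed
      with cI show "c \<in> {..<s} \<rightarrow>\<^sub>E I \<and> (\<forall>i\<in>I. ?N c i = n i)" by blast
    next
      fix c assume c: "c \<in> {..<s} \<rightarrow>\<^sub>E I" "\<forall>i\<in>I. ?N c i = n i"
      have "{i \<in> I. ?N c i = p} = {i \<in> I. n i = p}" "{i \<in> I. ?N c i = Suc p} = {i \<in> I. n i = Suc p}"
        using c(2) by auto
      moreover have "{i \<in> I. n i = p} = A" "{i \<in> I. n i = Suc p} = B"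
        using sub p by (auto simp: n_def split: if_splits)
      ultimately have "?pair c = (A, B)" by simp
      then show "c \<in> ?G \<and> ?pair c = (A, B)" using c(1) AB by (simp add: G)
    qed
    have "(\<Sum>c\<in>?L. \<Prod>j<s. x (c j)) = (\<Sum>c\<in>?L. \<Prod>i\<in>I. x i ^ n i)"
    proof (rule sum.cong[OF refl])
      fix c assume c: "c \<in> ?L"
      then have "c ` {..<s} \<subseteq> I" by auto
      then have "(\<Prod>j<s. x (c j)) = (\<Prod>i\<in>I. \<Prod>j\<in>{j \<in> {..<s}. c j = i}. x (c j))"
        using I by (intro prod.group[symmetric]) auto
      also have "\<dots> = (\<Prod>i\<in>I. x i ^ n i)"
      proof (rule prod.cong[OF refl])
        fix i assume "i \<in> I"
        have "(\<Prod>j\<in>{j \<in> {..<s}. c j = i}. x (c j)) = (\<Prod>j\<in>{j \<in> {..<s}. c j = i}. x i)"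
          by (rule prod.cong) auto
        then show "(\<Prod>j\<in>{j \<in> {..<s}. c j = i}. x (c j)) = x i ^ n i" using c \<open>i \<in> I\<close> by simp
      qed
      finally show "(\<Prod>j<s. x (c j)) = (\<Prod>i\<in>I. x i ^ n i)" .
    qed
    also have "\<dots> = real (card ?L) * (\<Prod>i\<in>I. x i ^ n i)" by simp
    also have "(\<Prod>i\<in>I. x i ^ n i) = (\<Prod>i\<in>A. x i ^ p) * (\<Prod>i\<in>B. x i ^ Suc p)"
      by (rule split[of "\<lambda>k i. x i ^ k"]) simp
    also have "real (card ?L) = turan_constant p a b"
    proof -
      have "(\<Prod>i\<in>I. fact (n i)) = (\<Prod>i\<in>A. fact p) * (\<Prod>i\<in>B. fact (Suc p) :: real)"
        by (rule split[of "\<lambda>k i. fact k"]) simp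
      also have "\<dots> = fact p ^ (a + b) * (real p + 1) ^ b"
        using sub by (simp add: power_add power_mult_distrib add.commute mult.commute)
      finally have 1: "(\<Prod>i\<in>I. fact (n i)) = fact p ^ (a + b) * (real p + 1) ^ b" .
      have "real (card ?L) * (\<Prod>i\<in>I. fact (n i)) = fact s"
        using arg_cong[OF card_labellings_with_class_sizes[OF I sumn], of real] by simp
      then show ?thesis unfolding 1 turan_constant_def s by (simp add: field_simps)
    qed
    finally show "(\<Sum>c\<in>{c \<in> ?G. ?pair c = (A, B)}. \<Prod>j<s. x (c j)) =
        turan_constant p a b * ((\<Prod>i\<in>A. x i ^ p) * (\<Prod>i\<in>B. x i ^ Suc p))"
      unfolding fibre .
  qed
  finally show ?thesis by (simp only: turan_poly_def sum_distrib_left case_prod_unfold)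
qed

section \<open>Densities in complete multipartite graphons\<close>

text \<open>
  Points outside all parts get the extra label \<open>length xs\<close>; no edge is incident with them, and they
  have probability zero.
\<close>

definition part_label :: "real list \<Rightarrow> real \<Rightarrow> nat" where
  "part_label xs u = (LEAST i. i = length xs \<or> u \<in> part_interval xs i)"

context
  fixes xs :: "real list"
  assumes xs: "part_weights xs"
begin

lemma sum_list_take_mono:
  assumes "i \<le> j"
  shows "sum_list (take i xs) \<le> sum_list (take j xs)"
proof -
  have "take j xs = take i xs @ drop i (take j xs)"
    using assms by (metis append_take_drop_id min.absorb1 take_take)
  then have "sum_list (take j xs) = sum_list (take i xs) + sum_list (drop i (take j xs))"
    by (metis sum_list_append)
  moreover have "0 \<le> sum_list (drop i (take j xs))"
    using xs by (intro sum_list_nonneg) (auto simp: part_weights_def dest!: in_set_dropD in_set_takeD intro: less_imp_le)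
  ultimately show ?thesis by simp
qed

lemma part_interval_disjoint:
  assumes "i < length xs" "j < length xs" "u \<in> part_interval xs i" "u \<in> part_interval xs j"
  shows "i = j"
proof -
  have *: False if "i < j" "j < length xs" "u \<in> part_interval xs i" "u \<in> part_interval xs j" for i j
  proof -
    have "u < sum_list (take (Suc i) xs)" "sum_list (take j xs) \<le> u"
      using that by (auto simp: part_interval_def split: if_splits)
    moreover have "sum_list (take (Suc i) xs) \<le> sum_list (take j xs)"
      using that by (intro sum_list_take_mono) simp
    ultimately show False by simp
  qed
  show ?thesis using *[of i j] *[of j i] assms by (metis linorder_neqE_nat)
qed

lemma part_label_eq_iff:
  assumes "i < length xs"
  shows "part_label xs u = i \<longleftrightarrow> u \<in> part_interval xs i"
proof
  let ?P = "\<lambda>i. i = length xs \<or> u \<in> part_interval xs i"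
  have P: "?P (part_label xs u)" unfolding part_label_def by (rule LeastI[of ?P "length xs"]) simp
  show "u \<in> part_interval xs i" if "part_label xs u = i" using P that assms by auto
  assume u: "u \<in> part_interval xs i"
  then have "part_label xs u \<le> i" unfolding part_label_def by (intro Least_le) simp
  with assms have "part_label xs u < length xs" by simp
  then show "part_label xs u = i" using P part_interval_disjoint[OF _ assms _ u] by auto
qed

lemma part_label_le: "part_label xs u \<le> length xs"
  unfolding part_label_def by (rule Least_le) simp

lemma multipartite_graphon_eq_1_iff:
  "multipartite_graphon xs u v = 1 \<longleftrightarrow>
     part_label xs u < length xs \<and> part_label xs v < length xs \<and> part_label xs u \<noteq> part_label xs v"
proof -
  have "(\<exists>i<length xs. \<exists>j<length xs. i \<noteq> j \<and> u \<in> part_interval xs i \<and> v \<in> part_interval xs j) \<longleftrightarrow>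
      (\<exists>i<length xs. \<exists>j<length xs. i \<noteq> j \<and> part_label xs u = i \<and> part_label xs v = j)"
    using part_label_eq_iff by blast
  then show ?thesis unfolding multipartite_graphon_def by auto
qed

lemma part_interval_sets: "part_interval xs i \<in> sets borel"
  by (auto simp: part_interval_def)

lemma measure_part_interval:
  assumes "i < length xs"
  shows "measure (uniform_measure lborel {0..1::real}) (part_interval xs i) = xs ! i"
proof -
  let ?P = "\<lambda>i. sum_list (take i xs)"
  have P: "?P (Suc i) = ?P i + xs ! i" using assms by (simp add: take_Suc_conv_app_nth)
  have all: "?P (length xs) = 1" using xs by (simp add: part_weights_def)
  have bounds: "0 \<le> ?P i" "?P (Suc i) \<le> 1" "?P i \<le> ?P (Suc i)"
    using sum_list_take_mono[of 0 i] sum_list_take_mono[of "Suc i" "length xs"] sum_list_take_mono[of i "Suc i"] all assms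
    by auto
  have sub: "{0..1} \<inter> part_interval xs i = part_interval xs i"
    using bounds by (auto simp: part_interval_def split: if_splits)
  have "measure (uniform_measure lborel {0..1::real}) (part_interval xs i) = measure lborel (part_interval xs i)"
    using part_interval_sets sub by (subst measure_uniform_measure) auto
  also have "\<dots> = ?P (Suc i) - ?P i"
    using bounds all by (auto simp: part_interval_def simp flip: all)
  finally show ?thesis using P by simp
qed

end

text \<open>
  The sampled graph depends on the points only through their labels. The label \<open>m\<close> of the points outside
  all parts makes a vertex isolated, which is where this differs from \<^const>\<open>label_graph\<close>.
\<close>

definition partial_label_graph :: "nat \<Rightarrow> nat \<Rightarrow> (nat \<Rightarrow> nat) \<Rightarrow> nat sgraph" where
  "partial_label_graph s m c =
     ({..<s}, {{i, j} | i j. i < s \<and> j < s \<and> i \<noteq> j \<and> c i < m \<and> c j < m \<and> c i \<noteq> c j})"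

text \<open>
  The event splits into finitely many boxes, one for each vector of labels, and the probability of a box
  is the product of the lengths of its parts.
\<close>

theorem induced_density_multipartite:
  fixes T :: "'a sgraph"
  assumes xs: "part_weights xs" and p: "0 < p" and s: "s = p * (a + b) + b"
    and T: "T = label_graph V d" "finite V" "card V = s" "class_count V d = turan_profile p a b"
  shows "induced_density T (multipartite_graphon xs) =
    turan_constant p a b * turan_poly p a b {..<length xs} ((!) xs)"
proof -
  let ?m = "length xs" and ?U = "uniform_measure lborel {0..1::real}"
  let ?lab = "part_label xs"
  let ?M = "Pi\<^sub>M {..<s} (\<lambda>_. ?U)"
  interpret U: prob_space ?U by (rule prob_space_uniform_measure) auto
  interpret finite_product_prob_space "\<lambda>_. ?U" "{..<s}" by unfold_locales auto
  define w where "w k = measure ?U (?lab -` {k})" for k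
  have vim: "?lab -` {k} = part_interval xs k" if "k < ?m" for k
    using part_label_eq_iff[OF xs that] by auto
  have vim_m: "?lab -` {?m} = UNIV - (\<Union>k<?m. part_interval xs k)"
  proof (rule set_eqI)
    fix u
    have "?lab u = ?m \<longleftrightarrow> \<not> (\<exists>k<?m. ?lab u = k)" using part_label_le[OF xs, of u] by auto
    also have "\<dots> \<longleftrightarrow> \<not> (\<exists>k<?m. u \<in> part_interval xs k)" using part_label_eq_iff[OF xs] by blast
    finally show "u \<in> ?lab -` {?m} \<longleftrightarrow> u \<in> UNIV - (\<Union>k<?m. part_interval xs k)" by auto
  qed
  have meas: "?lab -` {k} \<in> sets ?U" for k
  proof -
    consider "k < ?m" | "k = ?m" | "?m < k" by linarith
    then show ?thesis
    proof cases
      case 3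
      then have "?lab -` {k} = {}" using part_label_le[OF xs] by (auto simp: not_le[symmetric])
      then show ?thesis by simp
    qed (use vim vim_m part_interval_sets[OF xs] in \<open>auto intro!: sets.Diff\<close>)
  qed
  have w: "w k = xs ! k" if "k < ?m" for k
    using that by (simp add: w_def vim measure_part_interval[OF xs])
  have w_m: "w ?m = 0"
  proof -
    have "measure ?U (\<Union>k<?m. part_interval xs k) = (\<Sum>k<?m. measure ?U (part_interval xs k))"
      by (rule U.finite_measure_finite_Union)
        (use part_interval_sets[OF xs] part_interval_disjoint[OF xs] in \<open>auto simp: disjoint_family_on_def\<close>)
    also have "\<dots> = (\<Sum>k<?m. xs ! k)" by (intro sum.cong) (auto simp: measure_part_interval[OF xs])
    also have "\<dots> = 1" using xs by (simp add: part_weights_def sum_list_sum_nth atLeast0LessThan)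
    finally show ?thesis
      unfolding w_def vim_m using U.prob_compl[of "\<Union>k<?m. part_interval xs k"] part_interval_sets[OF xs] by auto
  qed
  let ?Q = "\<lambda>c. isomorphic (partial_label_graph s ?m c) T"
  let ?C = "{c \<in> {..<s} \<rightarrow>\<^sub>E {..?m}. ?Q c}"
  let ?box = "\<lambda>c. Pi\<^sub>E {..<s} (\<lambda>j. ?lab -` {c j})"
  have finC: "finite ?C" by (rule finite_subset[OF _ finite_PiE[of "{..<s}" "\<lambda>_. {..?m}"]]) auto
  have sample: "sampled_graph (multipartite_graphon xs) s x = partial_label_graph s ?m (restrict (\<lambda>j. ?lab (x j)) {..<s})" for x
    unfolding sampled_graph_def partial_label_graph_def multipartite_graphon_eq_1_iff[OF xs]
    by (auto simp: set_eq_iff)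
  have "{x \<in> space ?M. isomorphic (sampled_graph (multipartite_graphon xs) s x) T} = (\<Union>c\<in>?C. ?box c)"
  proof safe
    fix x assume x: "x \<in> space ?M" "isomorphic (sampled_graph (multipartite_graphon xs) s x) T"
    let ?c = "restrict (\<lambda>j. ?lab (x j)) {..<s}"
    have "?c \<in> ?C" using x(2) part_label_le[OF xs] by (auto simp: sample)
    moreover have "x \<in> ?box ?c" using x(1) by (auto simp: space_PiM PiE_iff)
    ultimately show "x \<in> (\<Union>c\<in>?C. ?box c)" by blast
  next
    fix c x assume c: "c \<in> {..<s} \<rightarrow>\<^sub>E {..?m}" "?Q c" "x \<in> ?box c"
    then have "restrict (\<lambda>j. ?lab (x j)) {..<s} = c" by (auto simp: PiE_iff extensional_def fun_eq_iff)
    then show "isomorphic (sampled_graph (multipartite_graphon xs) s x) T" using c by (simp add: sample)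
    show "x \<in> space ?M" using c by (auto simp: space_PiM PiE_iff)
  qed
  then have "induced_density T (multipartite_graphon xs) = measure ?M (\<Union>c\<in>?C. ?box c)"
    unfolding induced_density_def Let_def T(1) verts_label_graph T(3) by simp
  also have "\<dots> = (\<Sum>c\<in>?C. measure ?M (?box c))"
  proof (rule finite_measure_finite_Union[OF finC])
    show "?box ` ?C \<subseteq> sets ?M" using meas by (auto intro!: sets_PiM_I_finite)
    show "disjoint_family_on ?box ?C"
    proof (unfold disjoint_family_on_def, safe)
      fix c c' x assume c: "c \<in> {..<s} \<rightarrow>\<^sub>E {..?m}" "c' \<in> {..<s} \<rightarrow>\<^sub>E {..?m}" "c \<noteq> c'"
        and x: "x \<in> ?box c" "x \<in> ?box c'"
      have "c j = c' j" if "j \<in> {..<s}" for j using x that by (auto simp: PiE_iff)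
      then have "c = c'" by (rule PiE_ext[OF c(1,2)])
      with c(3) show "x \<in> {}" by blast
    qed
  qed
  also have "\<dots> = (\<Sum>c\<in>?C. \<Prod>j<s. w (c j))"
    unfolding w_def using meas by (intro sum.cong refl prob_times) auto
  also have "\<dots> = (\<Sum>c\<in>turan_labellings s p a b {..<?m}. \<Prod>j<s. w (c j))"
  proof (rule sum.mono_neutral_right[OF finC])
    have Q: "?Q c \<longleftrightarrow> class_count {..<s} c = turan_profile p a b" if "c \<in> {..<s} \<rightarrow>\<^sub>E {..<?m}" for c
    proof -
      have "c j < ?m" if "j < s" for j using that \<open>c \<in> _\<close> by auto
      then have "partial_label_graph s ?m c = label_graph {..<s} c"
        unfolding partial_label_graph_def label_graph_def by (auto simp: set_eq_iff)
      then show ?thesis using isomorphic_label_graph_iff[of "{..<s}" V c d] T by simp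
    qed
    show "turan_labellings s p a b {..<?m} \<subseteq> ?C"
    proof
      fix c assume "c \<in> turan_labellings s p a b {..<?m}"
      then show "c \<in> ?C" using Q by (force simp: turan_labellings_def PiE_iff)
    qed
    \<comment> \<open>Only vectors using the label of the points outside all parts are left.\<close>
    show "\<forall>c\<in>?C - turan_labellings s p a b {..<?m}. (\<Prod>j<s. w (c j)) = 0"
    proof
      fix c assume c: "c \<in> ?C - turan_labellings s p a b {..<?m}"
      then have "c \<notin> {..<s} \<rightarrow>\<^sub>E {..<?m}" using Q by (auto simp: turan_labellings_def)
      moreover have "c \<in> {..<s} \<rightarrow>\<^sub>E {..<?m}" if "\<forall>j<s. c j \<noteq> ?m"
      proof (rule PiE_I)
        show "c j \<in> {..<?m}" if "j \<in> {..<s}" for j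
          using c that \<open>\<forall>j<s. c j \<noteq> ?m\<close> PiE_mem[of c "{..<s}" "\<lambda>_. {..?m}" j] by (simp add: le_less)
        show "c j = undefined" if "j \<notin> {..<s}" for j
          using c that PiE_arb[of c "{..<s}" "\<lambda>_. {..?m}" j] by simp
      qed
      ultimately obtain j where "j < s" "c j = ?m" by blast
      then show "(\<Prod>j<s. w (c j)) = 0" using w_m by (intro prod_zero bexI[of _ j]) auto
    qed
  qed
  also have "\<dots> = (\<Sum>c\<in>turan_labellings s p a b {..<?m}. \<Prod>j<s. xs ! c j)"
    by (intro sum.cong prod.cong refl w) (auto simp: turan_labellings_def)
  also have "\<dots> = turan_constant p a b * turan_poly p a b {..<?m} ((!) xs)"
    by (rule sum_turan_labellings) (use p s in auto)
  finally show ?thesis .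
qed

section \<open>Copies in complete multipartite graphs\<close>

lemma class_count_image:
  assumes "inj_on f A"
  shows "class_count (f ` A) d = class_count A (d \<circ> f)"
proof
  fix n
  have "card {v \<in> f ` A. d v = i} = card {u \<in> A. (d \<circ> f) u = i}" for i
  proof -
    have "{v \<in> f ` A. d v = i} = f ` {u \<in> A. (d \<circ> f) u = i}" by auto
    then show ?thesis using assms by (metis (no_types, lifting) card_image inj_on_subset mem_Collect_eq subsetI)
  qed
  then show "class_count (f ` A) d n = class_count A (d \<circ> f) n"
    by (simp add: class_count_def image_comp)
qed

lemma class_count_cong:
  assumes "\<And>u. u \<in> A \<Longrightarrow> c u = d u"
  shows "class_count A c = class_count A d"
proof
  fix n
  have "{v \<in> A. c v = i} = {v \<in> A. d v = i}" for i using assms by auto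
  moreover have "c ` A = d ` A" using assms by (intro image_cong) auto
  ultimately show "class_count A c n = class_count A d n" unfolding class_count_def by simp
qed

text \<open>
  Each \<open>s\<close>-subset is the image of \<open>s!\<close> injections. Counting injections instead of subsets makes
  sampling without replacement comparable to sampling with replacement.
\<close>

lemma card_injections_by_image:
  assumes "finite V"
  shows "card {f \<in> {..<s} \<rightarrow>\<^sub>E V. inj_on f {..<s} \<and> P (f ` {..<s})} =
    fact s * card {S. S \<subseteq> V \<and> card S = s \<and> P S}"
proof -
  let ?F = "{f \<in> {..<s} \<rightarrow>\<^sub>E V. inj_on f {..<s} \<and> P (f ` {..<s})}"
  let ?S = "{S. S \<subseteq> V \<and> card S = s \<and> P S}"
  have "finite ({..<s} \<rightarrow>\<^sub>E V)" using assms by (intro finite_PiE) auto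
  then have finF: "finite ?F" by (rule rev_finite_subset) auto
  have finS: "finite ?S" using assms by simp
  have sub: "(\<lambda>f. f ` {..<s}) ` ?F \<subseteq> ?S"
  proof (rule image_subsetI)
    fix f assume "f \<in> ?F"
    then have "f ` {..<s} \<subseteq> V" "card (f ` {..<s}) = card {..<s}" "P (f ` {..<s})"
      using card_image by (blast elim: PiE_E)+
    then show "f ` {..<s} \<in> ?S" by simp
  qed
  have "card ?F = (\<Sum>S\<in>?S. card {f \<in> ?F. f ` {..<s} = S})"
    using sum.group[OF finF finS sub, of "\<lambda>_. 1::nat"] by simp
  also have "\<dots> = (\<Sum>S\<in>?S. fact s)"
  proof (rule sum.cong[OF refl])
    fix S assume S: "S \<in> ?S"
    then have finS: "finite S" using assms by (auto intro: finite_subset)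
    have "{f \<in> ?F. f ` {..<s} = S} = {f \<in> {..<s} \<rightarrow>\<^sub>E S. inj_on f {..<s}}"
    proof (rule set_eqI, rule iffI)
      fix f assume "f \<in> {f \<in> ?F. f ` {..<s} = S}"
      then show "f \<in> {f \<in> {..<s} \<rightarrow>\<^sub>E S. inj_on f {..<s}}" by (auto simp: PiE_iff)
    next
      fix f assume f: "f \<in> {f \<in> {..<s} \<rightarrow>\<^sub>E S. inj_on f {..<s}}"
      then have "f ` {..<s} \<subseteq> S" "card (f ` {..<s}) = card {..<s}" using card_image by blast+
      then have im: "f ` {..<s} = S" using S finS by (intro card_subset_eq) auto
      moreover have "f \<in> {..<s} \<rightarrow>\<^sub>E V" using f S by (auto simp: PiE_iff)
      ultimately show "f \<in> {f \<in> ?F. f ` {..<s} = S}" using f S by blast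
    qed
    then show "card {f \<in> ?F. f ` {..<s} = S} = fact s"
      using card_inj_on_subset_funcset[of "{..<s}" S "{..<s}"] finS S by (simp add: fact_prod_rev)
  qed
  finally show ?thesis by simp
qed

lemma induced_subgraph_label_graph:
  assumes "S \<subseteq> V"
  shows "induced_subgraph (label_graph V d) S = label_graph S d"
  using assms by (auto simp: induced_subgraph_def label_graph_def)

locale turan_target =
  fixes T :: "'a sgraph" and p a b s :: nat and W :: "'a set" and e :: "'a \<Rightarrow> 'j"
  assumes p_pos: "0 < p" and s_eq: "s = p * (a + b) + b"
    and T_eq: "T = label_graph W e" and finite_W: "finite W" and card_W: "card W = s"
    and profile: "class_count W e = turan_profile p a b"
begin

lemma card_verts [simp]: "card (verts T) = s"
  by (simp add: T_eq card_W)

lemma induced_copies_label_graph: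
  assumes "finite V"
  shows "fact s * induced_copies T (label_graph V d) =
    card {f \<in> {..<s} \<rightarrow>\<^sub>E V. inj_on f {..<s} \<and> class_count {..<s} (d \<circ> f) = turan_profile p a b}"
proof -
  have "induced_copies T (label_graph V d) =
      card {S. S \<subseteq> V \<and> card S = s \<and> class_count S d = turan_profile p a b}"
    unfolding induced_copies_def card_verts verts_label_graph
  proof (intro arg_cong[of _ _ card] Collect_cong conj_cong refl)
    fix S assume "S \<subseteq> V"
    then show "isomorphic (induced_subgraph (label_graph V d) S) T \<longleftrightarrow> class_count S d = turan_profile p a b"
      using assms isomorphic_label_graph_iff[of S W d e] finite_W profile
      by (simp add: induced_subgraph_label_graph T_eq finite_subset)
  qed
  then have "fact s * induced_copies T (label_graph V d) =
      card {f \<in> {..<s} \<rightarrow>\<^sub>E V. inj_on f {..<s} \<and> class_count (f ` {..<s}) d = turan_profile p a b}"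
    using card_injections_by_image[OF assms, of s "\<lambda>S. class_count S d = turan_profile p a b"] by simp
  also have "\<dots> = card {f \<in> {..<s} \<rightarrow>\<^sub>E V. inj_on f {..<s} \<and> class_count {..<s} (d \<circ> f) = turan_profile p a b}"
    by (intro arg_cong[of _ _ card] Collect_cong conj_cong refl) (simp only: class_count_image)
  finally show ?thesis .
qed

text \<open>
  Drawing \<open>s\<close> vertices with replacement amounts to sampling from the graphon whose part weights
  are the proportions of the label classes.
\<close>

lemma card_turan_maps:
  assumes V: "finite V" "card V = n" "0 < n" and I: "finite I" "d ` V \<subseteq> I"
  shows "real (card {f \<in> {..<s} \<rightarrow>\<^sub>E V. class_count {..<s} (d \<circ> f) = turan_profile p a b}) =
    real n ^ s * (turan_constant p a b * turan_poly p a b I (\<lambda>i. real (card {v \<in> V. d v = i}) / real n))"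
proof -
  let ?F = "{f \<in> {..<s} \<rightarrow>\<^sub>E V. class_count {..<s} (d \<circ> f) = turan_profile p a b}"
  let ?C = "turan_labellings s p a b I"
  let ?lab = "\<lambda>f. restrict (d \<circ> f) {..<s}"
  have "finite ({..<s} \<rightarrow>\<^sub>E V)" using V by (intro finite_PiE) auto
  then have finF: "finite ?F" by (rule rev_finite_subset) auto
  have "finite ({..<s} \<rightarrow>\<^sub>E I)" using I by (intro finite_PiE) auto
  then have finC: "finite ?C" by (rule rev_finite_subset) (auto simp: turan_labellings_def)
  have cc: "class_count {..<s} (?lab f) = class_count {..<s} (d \<circ> f)" for f
    by (rule class_count_cong) simp
  have sub: "?lab ` ?F \<subseteq> ?C"
  proof safe
    fix f assume f: "f \<in> {..<s} \<rightarrow>\<^sub>E V" "class_count {..<s} (d \<circ> f) = turan_profile p a b"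
    have "?lab f \<in> {..<s} \<rightarrow>\<^sub>E I" using f(1) I(2) by (auto simp: PiE_iff)
    with f(2) cc show "?lab f \<in> ?C" by (simp add: turan_labellings_def)
  qed
  have "card ?F = (\<Sum>c\<in>?C. card {f \<in> ?F. ?lab f = c})"
    using sum.group[OF finF finC sub, of "\<lambda>_. 1::nat"] by simp
  also have "\<dots> = (\<Sum>c\<in>?C. \<Prod>j<s. card {v \<in> V. d v = c j})"
  proof (rule sum.cong[OF refl])
    fix c assume c: "c \<in> ?C"
    have "{f \<in> ?F. ?lab f = c} = Pi\<^sub>E {..<s} (\<lambda>j. {v \<in> V. d v = c j})"
    proof (rule set_eqI)
      fix f
      have "class_count {..<s} (d \<circ> f) = turan_profile p a b" if "?lab f = c"
        using c unfolding cc[of f, symmetric] that turan_labellings_def by blast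
      then have "f \<in> ?F \<and> ?lab f = c \<longleftrightarrow> f \<in> {..<s} \<rightarrow>\<^sub>E V \<and> ?lab f = c" by blast
      also have "\<dots> \<longleftrightarrow> f \<in> {..<s} \<rightarrow>\<^sub>E V \<and> (\<forall>j<s. d (f j) = c j)"
      proof -
        have "c \<in> extensional {..<s}" using c by (auto simp: turan_labellings_def PiE_iff)
        then show ?thesis by (auto simp: fun_eq_iff extensional_def)
      qed
      also have "\<dots> \<longleftrightarrow> f \<in> Pi\<^sub>E {..<s} (\<lambda>j. {v \<in> V. d v = c j})" by (auto simp: PiE_iff)
      finally show "f \<in> {f \<in> ?F. ?lab f = c} \<longleftrightarrow> f \<in> Pi\<^sub>E {..<s} (\<lambda>j. {v \<in> V. d v = c j})" by simp
    qed
    then show "card {f \<in> ?F. ?lab f = c} = (\<Prod>j<s. card {v \<in> V. d v = c j})"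
      by (simp add: card_PiE)
  qed
  finally have "real (card ?F) = (\<Sum>c\<in>?C. \<Prod>j<s. real n * (real (card {v \<in> V. d v = c j}) / real n))"
    using V(3) by simp
  also have "\<dots> = real n ^ s * (\<Sum>c\<in>?C. \<Prod>j<s. real (card {v \<in> V. d v = c j}) / real n)"
    by (simp only: prod.distrib sum_distrib_left prod_constant card_lessThan)
  also have "(\<Sum>c\<in>?C. \<Prod>j<s. real (card {v \<in> V. d v = c j}) / real n) =
      turan_constant p a b * turan_poly p a b I (\<lambda>i. real (card {v \<in> V. d v = i}) / real n)"
    by (rule sum_turan_labellings[OF I(1) p_pos s_eq])
  finally show ?thesis .
qed

text \<open>
  The copies are counted by the injective maps among those of the previous lemma, and
  \<open>n ^ s - s! * (n choose s)\<close> is the number of noninjective maps. The upper bound has no error term,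
  so it is uniform in the number of parts, which may grow with \<open>n\<close>.
\<close>

lemma induced_copies_bounds:
  assumes V: "finite V" "card V = n" "0 < n" and I: "finite I" "d ` V \<subseteq> I"
  defines "D \<equiv> turan_constant p a b * turan_poly p a b I (\<lambda>i. real (card {v \<in> V. d v = i}) / real n)"
  shows "fact s * real (induced_copies T (label_graph V d)) \<le> real n ^ s * D"
    and "real n ^ s * D \<le> fact s * real (induced_copies T (label_graph V d)) + (real n ^ s - fact s * real (n choose s))"
proof -
  let ?A = "{..<s} \<rightarrow>\<^sub>E V"
  let ?F = "{f \<in> ?A. class_count {..<s} (d \<circ> f) = turan_profile p a b}"
  let ?J = "{f \<in> ?A. inj_on f {..<s}}"
  have finA: "finite ?A" using V by (intro finite_PiE) auto
  have cardA: "card ?A = n ^ s" using V by (simp add: card_funcsetE)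
  have cardJ: "card ?J = fact s * (n choose s)"
    using card_injections_by_image[OF V(1), of s "\<lambda>_. True"] V by (simp add: n_subsets)
  have F: "real (card ?F) = real n ^ s * D" unfolding D_def by (rule card_turan_maps[OF V I])
  have FJ: "fact s * induced_copies T (label_graph V d) = card (?F \<inter> ?J)"
    unfolding induced_copies_label_graph[OF V(1)] by (intro arg_cong[of _ _ card]) auto
  then have FJr: "fact s * real (induced_copies T (label_graph V d)) = real (card (?F \<inter> ?J))"
    by (metis of_nat_fact of_nat_mult)
  have "card (?F \<inter> ?J) \<le> card ?F" using finA by (intro card_mono) auto
  then show "fact s * real (induced_copies T (label_graph V d)) \<le> real n ^ s * D"
    using F FJr by simp
  have "card ?F \<le> card ((?F \<inter> ?J) \<union> (?A - ?J))" using finA by (intro card_mono) auto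
  also have "\<dots> \<le> card (?F \<inter> ?J) + card (?A - ?J)" by (rule card_Un_le)
  also have "card (?A - ?J) = card ?A - card ?J" using finA by (intro card_Diff_subset) auto
  finally have 1: "card ?F \<le> card (?F \<inter> ?J) + (card ?A - card ?J)" .
  have "card ?J \<le> card ?A" using finA by (intro card_mono) auto
  with 1 have "card ?F + card ?J \<le> card (?F \<inter> ?J) + card ?A" by linarith
  then have "real (card ?F) + real (card ?J) \<le> real (card (?F \<inter> ?J)) + real (card ?A)"
    by (simp flip: of_nat_add)
  then show "real n ^ s * D \<le> fact s * real (induced_copies T (label_graph V d)) + (real n ^ s - fact s * real (n choose s))"
    unfolding F FJr cardJ cardA by (simp add: algebra_simps)
qed

end

section \<open>Symmetrisation\<close>

lemma card_subsets_split:
  fixes u v :: 'a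
  assumes "finite V"
  shows "card {S. S \<subseteq> V \<and> P S} =
    card {S. S \<subseteq> V \<and> P S \<and> u \<notin> S \<and> v \<notin> S} + card {S. S \<subseteq> V \<and> P S \<and> u \<in> S \<and> v \<notin> S} +
    card {S. S \<subseteq> V \<and> P S \<and> u \<notin> S \<and> v \<in> S} + card {S. S \<subseteq> V \<and> P S \<and> u \<in> S \<and> v \<in> S}"
    (is "card ?X = card ?N + card ?U + card ?W + card ?B")
proof -
  have fin: "finite ?N" "finite ?U" "finite ?W" "finite ?B"
    using assms by (auto intro: finite_subset[of _ "Pow V"])
  have disj: "((?N \<union> ?U) \<union> ?W) \<inter> ?B = {}" "(?N \<union> ?U) \<inter> ?W = {}" "?N \<inter> ?U = {}" by blast+
  have "?X = ((?N \<union> ?U) \<union> ?W) \<union> ?B" by blast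
  then have "card ?X = card (((?N \<union> ?U) \<union> ?W) \<union> ?B)" by (rule arg_cong)
  also have "\<dots> = card ?N + card ?U + card ?W + card ?B"
    unfolding card_Un_disjoint[OF finite_UnI[OF finite_UnI[OF fin(1,2)] fin(3)] fin(4) disj(1)]
      card_Un_disjoint[OF finite_UnI[OF fin(1,2)] fin(3) disj(2)]
      card_Un_disjoint[OF fin(1,2) disj(3)] by (rule refl)
  finally show ?thesis .
qed

text \<open>
  Let \<open>P\<close> be a property of vertex sets before and \<open>Q\<close> after making \<open>v\<close> a clone of \<open>u\<close>. Sets
  containing \<open>v\<close> but not \<open>u\<close> now behave like those containing \<open>u\<close> but not \<open>v\<close>, which is why the
  latter are counted twice. Copies of a graph and pairs of twins are both instances.
\<close>

lemma card_subsets_after_cloning: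
  fixes u v :: 'a
  assumes V: "finite V" "u \<in> V" "v \<in> V" "u \<noteq> v"
    and PQ: "\<And>S. S \<subseteq> V \<Longrightarrow> \<not> (u \<in> S \<and> v \<in> S) \<Longrightarrow> P (id(v := u) ` S) \<Longrightarrow> Q S"
  shows "card {S. S \<subseteq> V \<and> P S \<and> u \<notin> S \<and> v \<notin> S} + 2 * card {S. S \<subseteq> V \<and> P S \<and> u \<in> S \<and> v \<notin> S}
    + card {S. S \<subseteq> V \<and> Q S \<and> u \<in> S \<and> v \<in> S} \<le> card {S. S \<subseteq> V \<and> Q S}"
proof -
  have fin: "finite {S. S \<subseteq> V \<and> R S}" for R
    using V by (auto intro: finite_subset[of _ "Pow V"])
  have id: "id(v := u) ` S = S" if "v \<notin> S" for S using that by (auto simp: image_iff)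
  have keep: "Q S" if "S \<subseteq> V" "P S" "v \<notin> S" for S
  proof (rule PQ[OF that(1)])
    show "\<not> (u \<in> S \<and> v \<in> S)" using that(3) by simp
    show "P (id(v := u) ` S)" unfolding id[OF that(3)] by (rule that(2))
  qed
  have 1: "card {S. S \<subseteq> V \<and> P S \<and> u \<notin> S \<and> v \<notin> S} \<le> card {S. S \<subseteq> V \<and> Q S \<and> u \<notin> S \<and> v \<notin> S}"
    by (intro card_mono fin) (use keep in auto)
  have 2: "card {S. S \<subseteq> V \<and> P S \<and> u \<in> S \<and> v \<notin> S} \<le> card {S. S \<subseteq> V \<and> Q S \<and> u \<in> S \<and> v \<notin> S}"
    by (intro card_mono fin) (use keep in auto)
  have 3: "card {S. S \<subseteq> V \<and> P S \<and> u \<in> S \<and> v \<notin> S} \<le> card {S. S \<subseteq> V \<and> Q S \<and> u \<notin> S \<and> v \<in> S}"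
  proof (rule card_inj_on_le[where f = "\<lambda>S. insert v (S - {u})"])
    show "inj_on (\<lambda>S. insert v (S - {u})) {S. S \<subseteq> V \<and> P S \<and> u \<in> S \<and> v \<notin> S}"
      by (rule inj_on_inverseI[where g = "\<lambda>S. insert u (S - {v})"]) (use V(4) in auto)
    show "(\<lambda>S. insert v (S - {u})) ` {S. S \<subseteq> V \<and> P S \<and> u \<in> S \<and> v \<notin> S} \<subseteq> {S. S \<subseteq> V \<and> Q S \<and> u \<notin> S \<and> v \<in> S}"
    proof (rule image_subsetI)
      fix S assume S: "S \<in> {S. S \<subseteq> V \<and> P S \<and> u \<in> S \<and> v \<notin> S}"
      let ?S = "insert v (S - {u})"
      have "id(v := u) ` ?S = insert u (id(v := u) ` (S - {u}))"
        unfolding image_insert fun_upd_same by (rule refl)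
      also have "id(v := u) ` (S - {u}) = S - {u}" using S by (intro id) blast
      also have "insert u (S - {u}) = S" using S by blast
      finally have "id(v := u) ` ?S = S" .
      then have "Q ?S" using S V by (intro PQ) auto
      then show "?S \<in> {S. S \<subseteq> V \<and> Q S \<and> u \<notin> S \<and> v \<in> S}" using S V by auto
    qed
  qed (rule fin)
  show ?thesis using 1 2 3 card_subsets_split[OF V(1), of Q u v] by linarith
qed

text \<open>
  Delete the edges at \<open>v\<close> and join \<open>v\<close> to the neighbours of \<open>u\<close>. Written as a pullback along the map that
  sends \<open>v\<close> to \<open>u\<close>, it needs no case distinctions.
\<close>

definition clone :: "'a \<Rightarrow> 'a \<Rightarrow> 'a set \<Rightarrow> 'a set set \<Rightarrow> 'a set set" where
  "clone u v V E = {{x, y} | x y. x \<in> V \<and> y \<in> V \<and> {(id(v := u)) x, (id(v := u)) y} \<in> E}"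

definition twins :: "'a set \<Rightarrow> 'a set set \<Rightarrow> 'a \<Rightarrow> 'a \<Rightarrow> bool" where
  "twins V E x y \<longleftrightarrow> (\<forall>z\<in>V. {x, z} \<in> E \<longleftrightarrow> {y, z} \<in> E)"

lemma clone_edge_iff:
  assumes "x \<in> V" "y \<in> V"
  shows "{x, y} \<in> clone u v V E \<longleftrightarrow> {(id(v := u)) x, (id(v := u)) y} \<in> E"
  using assms by (auto simp: clone_def doubleton_eq_iff insert_commute)

lemma simple_no_loop: "E \<subseteq> all_pairs V \<Longrightarrow> {x} \<notin> E"
  by (auto simp: all_pairs_def)

lemma clone_simple:
  assumes "E \<subseteq> all_pairs V"
  shows "clone u v V E \<subseteq> all_pairs V"
proof
  fix e assume "e \<in> clone u v V E"
  then obtain x y where e: "e = {x, y}" "x \<in> V" "y \<in> V" "{(id(v := u)) x, (id(v := u)) y} \<in> E"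
    by (auto simp: clone_def)
  moreover have "x \<noteq> y" using e(4) simple_no_loop[OF assms] by auto
  ultimately show "e \<in> all_pairs V" by (auto simp: all_pairs_def)
qed

lemma clone_contains_complete:
  assumes E: "E \<subseteq> all_pairs V" and u: "u \<in> V" and c: "contains_complete k (V, clone u v V E)"
  shows "contains_complete k (V, E)"
proof -
  let ?t = "id(v := u)"
  from c obtain S where S: "S \<subseteq> V" "card S = k" "all_pairs S \<subseteq> clone u v V E"
    by (auto simp: contains_complete_def)
  have edge: "{?t x, ?t y} \<in> E" if "x \<in> S" "y \<in> S" "x \<noteq> y" for x y
  proof -
    have "{x, y} \<in> all_pairs S" using that by (auto simp: all_pairs_def)
    then show ?thesis using S that clone_edge_iff[of x V y u v E] by blast
  qed
  have inj: "inj_on ?t S"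
  proof (rule inj_onI, rule ccontr)
    fix x y assume xy: "x \<in> S" "y \<in> S" "?t x = ?t y" "x \<noteq> y"
    have "{?t x} \<in> E" using edge[OF xy(1,2,4)] unfolding xy(3) by (simp only: insert_absorb2)
    then show False using simple_no_loop[OF E] by blast
  qed
  have "all_pairs (?t ` S) \<subseteq> E"
  proof
    fix e assume "e \<in> all_pairs (?t ` S)"
    then obtain x' y' where "e = {x', y'}" "x' \<in> ?t ` S" "y' \<in> ?t ` S" "x' \<noteq> y'"
      by (auto simp: all_pairs_def card_2_iff)
    then show "e \<in> E" using edge by blast
  qed
  moreover have "?t ` S \<subseteq> V" using S u by auto
  moreover have "card (?t ` S) = k" using S inj by (simp only: card_image)
  ultimately show ?thesis unfolding contains_complete_def fst_conv snd_conv by blast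
qed

lemma twins_clone:
  assumes "x \<in> V" "y \<in> V" "u \<in> V" "twins V E ((id(v := u)) x) ((id(v := u)) y)"
  shows "twins V (clone u v V E) x y"
  unfolding twins_def
proof
  fix z assume z: "z \<in> V"
  then have "(id(v := u)) z \<in> V" using assms by auto
  then show "{x, z} \<in> clone u v V E \<longleftrightarrow> {y, z} \<in> clone u v V E"
    using assms z unfolding clone_edge_iff[OF assms(1) z] clone_edge_iff[OF assms(2) z] by (simp only: twins_def)
qed

lemma isomorphic_induced_label_graph_iff:
  "isomorphic (induced_subgraph (V, E) S) (label_graph W e) \<longleftrightarrow>
    (\<exists>f. bij_betw f S W \<and> (\<forall>x\<in>S. \<forall>y\<in>S. {x, y} \<in> E \<longleftrightarrow> e (f x) \<noteq> e (f y)))"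
proof -
  have "({x, y} \<in> {e \<in> E. e \<subseteq> S} \<longleftrightarrow> {f x, f y} \<in> edges (label_graph W e)) \<longleftrightarrow>
     ({x, y} \<in> E \<longleftrightarrow> e (f x) \<noteq> e (f y))" if "bij_betw f S W" "x \<in> S" "y \<in> S" for f x y
    using that edge_label_graph_iff[of "f x" W "f y" e] by (auto dest: bij_betw_apply)
  then show ?thesis unfolding isomorphic_def induced_subgraph_def fst_conv snd_conv verts_label_graph
    by (intro ex_cong1 conj_cong ball_cong refl) auto
qed

lemma copies_clone:
  assumes u: "u \<in> V" and S: "S \<subseteq> V"
    and iso: "isomorphic (induced_subgraph (V, E) (id(v := u) ` S)) (label_graph W e)" and not_both: "\<not> (u \<in> S \<and> v \<in> S)"
  shows "isomorphic (induced_subgraph (V, clone u v V E) S) (label_graph W e)"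
proof -
  let ?t = "id(v := u)"
  have inj: "inj_on ?t S" using not_both by (auto simp: inj_on_def)
  from iso obtain f where f: "bij_betw f (?t ` S) W"
    "\<And>x y. x \<in> ?t ` S \<Longrightarrow> y \<in> ?t ` S \<Longrightarrow> {x, y} \<in> E \<longleftrightarrow> e (f x) \<noteq> e (f y)"
    unfolding isomorphic_induced_label_graph_iff by blast
  show ?thesis unfolding isomorphic_induced_label_graph_iff
  proof (intro exI[of _ "f \<circ> ?t"] conjI ballI)
    show "bij_betw (f \<circ> ?t) S W" using f(1) inj by (meson bij_betw_trans inj_on_imp_bij_betw)
    fix x y assume xy: "x \<in> S" "y \<in> S"
    show "{x, y} \<in> clone u v V E \<longleftrightarrow> e ((f \<circ> ?t) x) \<noteq> e ((f \<circ> ?t) y)"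
      using f(2)[of "?t x" "?t y"] xy S clone_edge_iff[of x V y u v E] unfolding o_apply by blast
  qed
qed

text \<open>
  In a copy of a complete multipartite graph, nonadjacent vertices \<open>u\<close> and \<open>v\<close> are twins, so a copy
  containing both is not changed by cloning.
\<close>

lemma copies_clone_both:
  assumes u: "u \<in> V" and S: "S \<subseteq> V" "u \<in> S" "v \<in> S" and nonadj: "{u, v} \<notin> E"
    and iso: "isomorphic (induced_subgraph (V, E) S) (label_graph W e)"
  shows "isomorphic (induced_subgraph (V, clone u v V E) S) (label_graph W e)"
proof -
  let ?t = "id(v := u)"
  from iso obtain f where f: "bij_betw f S W"
    "\<And>x y. x \<in> S \<Longrightarrow> y \<in> S \<Longrightarrow> {x, y} \<in> E \<longleftrightarrow> e (f x) \<noteq> e (f y)"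
    unfolding isomorphic_induced_label_graph_iff by blast
  have uv: "e (f u) = e (f v)" using f(2)[OF S(2,3)] nonadj by blast
  have t: "?t x \<in> S \<and> e (f (?t x)) = e (f x)" if "x \<in> S" for x using that uv S by simp
  show ?thesis unfolding isomorphic_induced_label_graph_iff
  proof (intro exI[of _ f] conjI ballI f(1))
    fix x y assume xy: "x \<in> S" "y \<in> S"
    then show "{x, y} \<in> clone u v V E \<longleftrightarrow> e (f x) \<noteq> e (f y)"
      using f(2)[of "?t x" "?t y"] t[of x] t[of y] S(1) clone_edge_iff[of x V y u v E] by (metis subsetD)
  qed
qed

definition twin_pairs :: "'a set \<Rightarrow> 'a set set \<Rightarrow> 'a set set" where
  "twin_pairs V E = {S. S \<subseteq> V \<and> (card S = 2 \<and> (\<forall>x\<in>S. \<forall>y\<in>S. twins V E x y))}"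

text \<open>
  Cloning \<open>u\<close> doubles the copies through \<open>u\<close> alone and loses those through \<open>v\<close> alone. On average over
  cloning \<open>u\<close> and cloning \<open>v\<close>, nothing is lost.
\<close>

lemma induced_copies_clone:
  fixes T :: "'b sgraph" and E :: "'a set set"
  assumes V: "finite V" "u \<in> V" "v \<in> V" "u \<noteq> v" "{u, v} \<notin> E"
    and T: "T = label_graph W e"
  shows "2 * induced_copies T (V, E) \<le>
    induced_copies T (V, clone u v V E) + induced_copies T (V, clone v u V E)"
proof -
  define P where "P E S \<longleftrightarrow> card S = card (verts T) \<and> isomorphic (induced_subgraph (V, E) S) T" for E :: "'a set set" and S
  have ic: "induced_copies T (V, E) = card {S. S \<subseteq> V \<and> P E S}" for E
    by (simp add: induced_copies_def P_def)
  have PQ: "P (clone u v V E) S"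
    if "u \<in> V" "S \<subseteq> V" "\<not> (u \<in> S \<and> v \<in> S)" "P E (id(v := u) ` S)" for u v S
  proof -
    have "inj_on (id(v := u)) S" using that(3) by (auto simp: inj_on_def)
    then have "card (id(v := u) ` S) = card S" by (rule card_image)
    then show ?thesis using that copies_clone[OF that(1,2) _ that(3), of E W e] unfolding P_def T by simp
  qed
  have both: "card {S. S \<subseteq> V \<and> P E S \<and> u \<in> S \<and> v \<in> S} \<le> card {S. S \<subseteq> V \<and> P (clone u v V E) S \<and> u \<in> S \<and> v \<in> S}"
    if "u \<in> V" "{u, v} \<notin> E" for u v
    using V(1) copies_clone_both[OF that(1) _ _ _ that(2), of _ W e] unfolding P_def T
    by (intro card_mono) (auto intro: finite_subset[of _ "Pow V"])
  have swap: "{S. S \<subseteq> V \<and> P E S \<and> v \<notin> S \<and> u \<notin> S} = {S. S \<subseteq> V \<and> P E S \<and> u \<notin> S \<and> v \<notin> S}"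
    "{S. S \<subseteq> V \<and> P E S \<and> v \<in> S \<and> u \<notin> S} = {S. S \<subseteq> V \<and> P E S \<and> u \<notin> S \<and> v \<in> S}"
    "{S. S \<subseteq> V \<and> P E S \<and> v \<in> S \<and> u \<in> S} = {S. S \<subseteq> V \<and> P E S \<and> u \<in> S \<and> v \<in> S}"
    by (rule Collect_cong, blast)+
  have "card {S. S \<subseteq> V \<and> P E S \<and> u \<notin> S \<and> v \<notin> S} + 2 * card {S. S \<subseteq> V \<and> P E S \<and> u \<in> S \<and> v \<notin> S}
    + card {S. S \<subseteq> V \<and> P (clone u v V E) S \<and> u \<in> S \<and> v \<in> S} \<le> card {S. S \<subseteq> V \<and> P (clone u v V E) S}"
    by (rule card_subsets_after_cloning) (use V PQ[OF V(2)] in auto)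
  moreover have "card {S. S \<subseteq> V \<and> P E S \<and> v \<notin> S \<and> u \<notin> S} + 2 * card {S. S \<subseteq> V \<and> P E S \<and> v \<in> S \<and> u \<notin> S}
    + card {S. S \<subseteq> V \<and> P (clone v u V E) S \<and> v \<in> S \<and> u \<in> S} \<le> card {S. S \<subseteq> V \<and> P (clone v u V E) S}"
    by (rule card_subsets_after_cloning) (use V PQ[OF V(3)] in auto)
  moreover have "{v, u} \<notin> E" using V(5) unfolding insert_commute[of v u] .
  then have "card {S. S \<subseteq> V \<and> P E S \<and> v \<in> S \<and> u \<in> S} \<le> card {S. S \<subseteq> V \<and> P (clone v u V E) S \<and> v \<in> S \<and> u \<in> S}"
    by (rule both[OF V(3)])
  ultimately show ?thesis
    using both[OF V(2,5)] card_subsets_split[OF V(1), of "P E" u v] unfolding ic swap by linarith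
qed

text \<open>
  The same averaging for pairs of twins, with a strict gain because \<open>u\<close> and \<open>v\<close> become twins.
\<close>

lemma twin_pairs_clone:
  assumes V: "finite V" "u \<in> V" "v \<in> V" "u \<noteq> v" "\<not> twins V E u v"
  shows "2 * card (twin_pairs V E) < card (twin_pairs V (clone u v V E)) + card (twin_pairs V (clone v u V E))"
proof -
  define P where "P E S \<longleftrightarrow> card S = 2 \<and> (\<forall>x\<in>S. \<forall>y\<in>S. twins V E x y)" for E :: "'a set set" and S
  have tp: "twin_pairs V E = {S. S \<subseteq> V \<and> P E S}" for E by (simp add: twin_pairs_def P_def)
  have PQ: "P (clone u v V E) S"
    if "u \<in> V" "S \<subseteq> V" "\<not> (u \<in> S \<and> v \<in> S)" "P E (id(v := u) ` S)" for u v S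
  proof -
    have "inj_on (id(v := u)) S" using that(3) by (auto simp: inj_on_def)
    then have "card (id(v := u) ` S) = card S" by (rule card_image)
    then show ?thesis using that(4) unfolding P_def
      using twins_clone[OF _ _ that(1)] that(2) by (metis imageI subsetD)
  qed
  have none: "{S. S \<subseteq> V \<and> P E S \<and> u \<in> S \<and> v \<in> S} = {}" using V(5) by (auto simp: P_def)
  have one: "0 < card {S. S \<subseteq> V \<and> P (clone u v V E) S \<and> u \<in> S \<and> v \<in> S}"
    if "u \<in> V" "v \<in> V" "u \<noteq> v" for u v
  proof -
    have "twins V (clone u v V E) x y" if "x \<in> {u, v}" "y \<in> {u, v}" for x y
      by (rule twins_clone) (use that \<open>u \<in> V\<close> \<open>v \<in> V\<close> in \<open>auto simp: twins_def\<close>)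
    then have "{u, v} \<in> {S. S \<subseteq> V \<and> P (clone u v V E) S \<and> u \<in> S \<and> v \<in> S}"
      unfolding P_def using that by simp
    moreover have "finite {S. S \<subseteq> V \<and> P (clone u v V E) S \<and> u \<in> S \<and> v \<in> S}"
      using V(1) by (auto intro: finite_subset[of _ "Pow V"])
    ultimately show ?thesis using card_gt_0_iff by blast
  qed
  have swap: "{S. S \<subseteq> V \<and> P E S \<and> v \<notin> S \<and> u \<notin> S} = {S. S \<subseteq> V \<and> P E S \<and> u \<notin> S \<and> v \<notin> S}"
    "{S. S \<subseteq> V \<and> P E S \<and> v \<in> S \<and> u \<notin> S} = {S. S \<subseteq> V \<and> P E S \<and> u \<notin> S \<and> v \<in> S}"
    "{S. S \<subseteq> V \<and> P E S \<and> v \<in> S \<and> u \<in> S} = {S. S \<subseteq> V \<and> P E S \<and> u \<in> S \<and> v \<in> S}"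
    by (rule Collect_cong, blast)+
  have "card {S. S \<subseteq> V \<and> P E S \<and> u \<notin> S \<and> v \<notin> S} + 2 * card {S. S \<subseteq> V \<and> P E S \<and> u \<in> S \<and> v \<notin> S}
    + card {S. S \<subseteq> V \<and> P (clone u v V E) S \<and> u \<in> S \<and> v \<in> S} \<le> card {S. S \<subseteq> V \<and> P (clone u v V E) S}"
    by (rule card_subsets_after_cloning) (use V PQ[OF V(2)] in auto)
  moreover have "card {S. S \<subseteq> V \<and> P E S \<and> v \<notin> S \<and> u \<notin> S} + 2 * card {S. S \<subseteq> V \<and> P E S \<and> v \<in> S \<and> u \<notin> S}
    + card {S. S \<subseteq> V \<and> P (clone v u V E) S \<and> v \<in> S \<and> u \<in> S} \<le> card {S. S \<subseteq> V \<and> P (clone v u V E) S}"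
    by (rule card_subsets_after_cloning) (use V PQ[OF V(3)] in auto)
  ultimately show ?thesis
    using one[OF V(2,3,4)] card_subsets_split[OF V(1), of "P E" u v]
    unfolding tp none swap card.empty by linarith
qed

text \<open>
  Zykov symmetrisation. Among all graphs on the same vertices whose cliques have sizes that already
  occur in \<open>G\<close>, maximise the number of copies and, as a tie-breaker of smaller weight, the number of
  pairs of twins. If two nonadjacent vertices were not twins, one of the two clonings would increase this
  weighted sum. So nonadjacency implies being twins, and the maximising graph is complete multipartite.
\<close>

theorem exists_multipartite_with_more_copies:
  fixes G :: "'a sgraph" and T :: "'b sgraph"
  assumes G: "simple_graph G" and T: "T = label_graph W e"
  obtains d :: "'a \<Rightarrow> nat" and m where "d ` verts G = {..<m}"
    "induced_copies T G \<le> induced_copies T (label_graph (verts G) d)"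
    "\<And>k. \<not> contains_complete k G \<Longrightarrow> m < k"
proof -
  obtain V E0 where G_eq: "G = (V, E0)" by (cases G)
  have V: "finite V" and E0: "E0 \<subseteq> all_pairs V" using G by (auto simp: G_eq simple_graph_def)
  let ?X = "{E. E \<subseteq> all_pairs V \<and> (\<forall>k. contains_complete k (V, E) \<longrightarrow> contains_complete k (V, E0))}"
  \<comment> \<open>There are fewer than this many pairs of twins, so copies take precedence.\<close>
  define N where "N = Suc (2 ^ card V)"
  define Psi where "Psi E = N * induced_copies T (V, E) + card (twin_pairs V E)" for E
  have tp: "card (twin_pairs V E) < N" for E
  proof -
    have "card (twin_pairs V E) \<le> card (Pow V)" using V by (intro card_mono) (auto simp: twin_pairs_def)
    then show ?thesis using V by (simp add: N_def card_Pow)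
  qed
  have "finite (all_pairs V)" using V by (auto simp: all_pairs_def intro: finite_subset[of _ "Pow V"])
  then have "finite ?X" by (auto intro: finite_subset[of _ "Pow (all_pairs V)"])
  moreover have "E0 \<in> ?X" using E0 by simp
  ultimately have "Max (Psi ` ?X) \<in> Psi ` ?X" and fX: "finite (Psi ` ?X)" by (blast intro: Max_in)+
  then obtain E where E: "E \<in> ?X" and "Psi E = Max (Psi ` ?X)" by fastforce
  then have max: "Psi E' \<le> Psi E" if "E' \<in> ?X" for E' using Max_ge[OF fX imageI[OF that]] by simp
  have copies: "induced_copies T (V, E0) \<le> induced_copies T (V, E)"
  proof -
    have "N * induced_copies T (V, E0) < N * Suc (induced_copies T (V, E))"
      using max[OF \<open>E0 \<in> ?X\<close>] tp[of E] unfolding Psi_def by simp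
    then show ?thesis by (simp only: mult_less_cancel1 less_Suc_eq_le)
  qed
  have clone_X: "clone u v V E \<in> ?X" if "u \<in> V" for u v
  proof (rule CollectI, intro conjI allI impI)
    from E have simple: "E \<subseteq> all_pairs V" by simp
    then show "clone u v V E \<subseteq> all_pairs V" by (rule clone_simple)
    fix k assume "contains_complete k (V, clone u v V E)"
    then have "contains_complete k (V, E)" by (rule clone_contains_complete[OF simple that])
    with E show "contains_complete k (V, E0)" by simp
  qed
  have tw: "twins V E u v" if uv: "u \<in> V" "v \<in> V" "{u, v} \<notin> E" for u v
  proof (rule ccontr)
    assume nt: "\<not> twins V E u v"
    then have ne: "u \<noteq> v" by (auto simp: twins_def)
    have "2 * card (twin_pairs V E) < card (twin_pairs V (clone u v V E)) + card (twin_pairs V (clone v u V E))"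
      by (rule twin_pairs_clone[OF V uv(1,2) ne nt])
    moreover have "N * (2 * induced_copies T (V, E)) \<le>
        N * (induced_copies T (V, clone u v V E) + induced_copies T (V, clone v u V E))"
      by (rule mult_le_mono2) (rule induced_copies_clone[OF V uv(1,2) ne uv(3) T])
    ultimately have "2 * Psi E < Psi (clone u v V E) + Psi (clone v u V E)"
      unfolding Psi_def by (simp add: algebra_simps)
    then show False using max[OF clone_X[OF uv(1), of v]] max[OF clone_X[OF uv(2), of u]] by linarith
  qed
  \<comment> \<open>The part of a vertex, as the set of vertices not adjacent to it.\<close>
  define D where "D x = {y \<in> V. {x, y} \<notin> E}" for x
  have D: "{x, y} \<in> E \<longleftrightarrow> D x \<noteq> D y" if "x \<in> V" "y \<in> V" for x y
  proof
    assume "{x, y} \<in> E"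
    then have "y \<notin> D x" by (simp add: D_def)
    moreover have "y \<in> D y" using that(2) E simple_no_loop[of E V y] by (simp add: D_def)
    ultimately show "D x \<noteq> D y" by blast
  next
    assume "D x \<noteq> D y"
    then show "{x, y} \<in> E" using tw[OF that] by (auto simp: D_def twins_def)
  qed
  obtain h m where h: "bij_betw h (D ` V) {..<m::nat}"
    using ex_bij_betw_finite_nat[of "D ` V"] V by (auto simp: atLeast0LessThan)
  define d where "d = h \<circ> D"
  have dV: "d ` V = {..<m}" using h by (simp add: d_def bij_betw_def image_comp)
  have d: "{x, y} \<in> E \<longleftrightarrow> d x \<noteq> d y" if "x \<in> V" "y \<in> V" for x y
    using D[OF that] h that by (auto simp: d_def bij_betw_def inj_on_def)
  have eq: "(V, E) = label_graph V d"
  proof -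
    have "E = {{u, v} | u v. u \<in> V \<and> v \<in> V \<and> d u \<noteq> d v}"
    proof (rule set_eqI, rule iffI)
      fix e assume e: "e \<in> E"
      then obtain x y where "e = {x, y}" "x \<in> V" "y \<in> V" using E by (auto simp: all_pairs_def card_2_iff)
      then show "e \<in> {{u, v} | u v. u \<in> V \<and> v \<in> V \<and> d u \<noteq> d v}" using e d by blast
    qed (use d in blast)
    then show ?thesis by (simp add: label_graph_def)
  qed
  show thesis
  proof (rule that)
    show "d ` verts G = {..<m}" using dV by (simp add: G_eq)
    show "induced_copies T G \<le> induced_copies T (label_graph (verts G) d)"
      using copies by (simp add: G_eq eq)
    fix k assume k: "\<not> contains_complete k G"
    show "m < k"
    proof (rule ccontr)
      assume "\<not> m < k"
      then have "{..<k} \<subseteq> d ` V" using dV by auto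
      then obtain S where S: "S \<subseteq> V" "inj_on d S" "d ` S = {..<k}"
        by (metis subset_image_inj)
      have "card S = k" using card_image[OF S(2)] S(3) by simp
      moreover have "all_pairs S \<subseteq> E"
      proof
        fix e assume "e \<in> all_pairs S"
        then obtain x y where "e = {x, y}" "x \<in> S" "y \<in> S" "x \<noteq> y" by (auto simp: all_pairs_def card_2_iff)
        then show "e \<in> E" using d[of x y] S by (auto simp: inj_on_def)
      qed
      ultimately have "contains_complete k (V, E)" using S(1) by (auto simp: contains_complete_def)
      then show False using E k by (simp add: G_eq)
    qed
  qed
qed

section \<open>Inducibility of Turan graphs\<close>

lemma finite_frequencies:
  fixes T :: "'b sgraph"
  shows "finite {induced_freq T G | G :: nat sgraph. simple_graph G \<and> card (verts G) = n}"
proof (rule finite_subset)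
  show "{induced_freq T G | G :: nat sgraph. simple_graph G \<and> card (verts G) = n} \<subseteq>
    (\<lambda>c. real c / real (n choose card (verts T))) ` {..2 ^ n}"
  proof safe
    fix G :: "nat sgraph" assume G: "simple_graph G" "n = card (verts G)"
    then have fin: "finite (verts G)" by (simp add: simple_graph_def)
    have "induced_copies T G \<le> card (Pow (verts G))"
      unfolding induced_copies_def using fin by (intro card_mono) auto
    then have "induced_copies T G \<le> 2 ^ card (verts G)" using fin by (simp add: card_Pow)
    then show "induced_freq T G \<in> (\<lambda>c. real c / real (card (verts G) choose card (verts T))) ` {..2 ^ card (verts G)}"
      by (auto simp: induced_freq_def)
  qed
qed simp

lemma finite_frequencies_free:
  fixes T :: "'b sgraph"
  shows "finite {induced_freq T G | G :: nat sgraph. simple_graph G \<and> card (verts G) = n \<and> \<not> contains_complete k G}"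
  by (rule finite_subset[OF _ finite_frequencies[of T n]]) blast

lemma simple_label_graph: "finite V \<Longrightarrow> simple_graph (label_graph V d)"
  by (auto simp: simple_graph_def label_graph_def all_pairs_def card_2_iff)

lemma label_graph_not_contains_complete:
  assumes "finite I" "d ` V \<subseteq> I" "card I < k"
  shows "\<not> contains_complete k (label_graph V d)"
proof
  assume "contains_complete k (label_graph V d)"
  then obtain S where S: "S \<subseteq> V" "card S = k" "all_pairs S \<subseteq> edges (label_graph V d)"
    by (auto simp: contains_complete_def)
  have "inj_on d S"
  proof (rule inj_onI, rule ccontr)
    fix x y assume xy: "x \<in> S" "y \<in> S" "d x = d y" "x \<noteq> y"
    then have "{x, y} \<in> all_pairs S" by (auto simp: all_pairs_def)
    then have "{x, y} \<in> edges (label_graph V d)" using S(3) by blast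
    then show False using edge_label_graph_iff[of x V y d] xy S(1) by blast
  qed
  then have "card S \<le> card I" using S(1) assms by (intro card_inj_on_le) auto
  then show False using S(2) assms(3) by simp
qed

lemma falling_factorial_ratio_tendsto_1:
  "(\<lambda>n. fact s * real (n choose s) / real n ^ s) \<longlonglongrightarrow> 1"
proof -
  have "(\<lambda>n. \<Prod>i<s. 1 - real i / real n) \<longlonglongrightarrow> (\<Prod>i<s. 1 - 0)"
    by (intro tendsto_prod tendsto_diff tendsto_const lim_const_over_n)
  moreover have "eventually (\<lambda>n. (\<Prod>i<s. 1 - real i / real n) = fact s * real (n choose s) / real n ^ s) sequentially"
    using eventually_gt_at_top[of 0]
  proof eventually_elim
    case (elim n)
    have "fact s * real (n choose s) = (\<Prod>i<s. real n - real i)"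
      by (simp add: binomial_gbinomial gbinomial_prod_rev atLeast0LessThan)
    also have "\<dots> = (\<Prod>i<s. real n * (1 - real i / real n))"
      using elim by (intro prod.cong) (auto simp: field_simps)
    also have "\<dots> = real n ^ s * (\<Prod>i<s. 1 - real i / real n)" by (simp add: prod.distrib)
    finally show ?case using elim by simp
  qed
  ultimately show ?thesis by (simp add: tendsto_cong)
qed

lemma tendsto_turan_poly:
  assumes "\<And>i. i \<in> I \<Longrightarrow> (\<lambda>n. x n i) \<longlonglongrightarrow> y i"
  shows "(\<lambda>n. turan_poly p a b I (x n)) \<longlonglongrightarrow> turan_poly p a b I y"
  unfolding turan_poly_def case_prod_unfold
  by (intro tendsto_intros) (auto simp: part_pairs_def intro!: assms)

text \<open>
  The residue classes modulo \<open>l\<close> partition \<open>{..<n}\<close> as evenly as possible and thus provide asymptotically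
  optimal host graphs for every \<open>n\<close>.
\<close>

lemma residue_class_density:
  assumes "0 < l" "i < l"
  shows "(\<lambda>n. real (card {v \<in> {..<n}. v mod l = i}) / real n) \<longlonglongrightarrow> 1 / real l"
proof (rule tendsto_sandwich)
  have lo: "real n / real l - 1 \<le> real (card {v \<in> {..<n}. v mod l = i})" for n
  proof -
    have "real n / real l - 1 \<le> real (n div l)"
      using assms by (metis add_diff_cancel_right' diff_right_mono floor_divide_of_nat_eq floor_eq_iff less_eq_real_def of_int_of_nat_eq)
    also have "n div l \<le> card {v \<in> {..<n}. v mod l = i}"
      using card_residue_class(1)[OF assms(2), of n] by simp
    finally show ?thesis by simp
  qed
  have hi: "real (card {v \<in> {..<n}. v mod l = i}) \<le> real n / real l + 1" for n
  proof -
    have "card {v \<in> {..<n}. v mod l = i} \<le> n div l + 1"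
      using card_residue_class(2)[OF assms(2), of n] by simp
    then have "real (card {v \<in> {..<n}. v mod l = i}) \<le> real (n div l) + 1" by linarith
    also have "real (n div l) \<le> real n / real l" by (rule of_nat_div_le_of_nat)
    finally show ?thesis by simp
  qed
  show "eventually (\<lambda>n. 1 / real l - 1 / real n \<le> real (card {v \<in> {..<n}. v mod l = i}) / real n) sequentially"
    using eventually_gt_at_top[of 0]
  proof eventually_elim
    case (elim n)
    have "1 / real l - 1 / real n = (real n / real l - 1) / real n" using elim by (simp add: diff_divide_distrib)
    also have "\<dots> \<le> real (card {v \<in> {..<n}. v mod l = i}) / real n" by (rule divide_right_mono[OF lo]) simp
    finally show ?case .
  qed
  show "eventually (\<lambda>n. real (card {v \<in> {..<n}. v mod l = i}) / real n \<le> 1 / real l + 1 / real n) sequentially"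
    using eventually_gt_at_top[of 0]
  proof eventually_elim
    case (elim n)
    have "real (card {v \<in> {..<n}. v mod l = i}) / real n \<le> (real n / real l + 1) / real n" by (rule divide_right_mono[OF hi]) simp
    also have "\<dots> = 1 / real l + 1 / real n" using elim by (simp add: add_divide_distrib)
    finally show ?case .
  qed
  show "(\<lambda>n. 1 / real l - 1 / real n) \<longlonglongrightarrow> 1 / real l"
    using tendsto_diff[OF tendsto_const lim_1_over_n, of "1 / real l"] by simp
  show "(\<lambda>n. 1 / real l + 1 / real n) \<longlonglongrightarrow> 1 / real l"
    using tendsto_add[OF tendsto_const lim_1_over_n, of "1 / real l"] by simp
qed

locale turan_extremal = turan_target T p a b s W e + turning_point p a b t
  for T :: "'a sgraph" and p a b s W and e :: "'a \<Rightarrow> 'j" and t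
begin

text \<open>
  The optimal density for at most \<open>M\<close> parts. The number \<open>M = k - 1\<close> describes graphs without a complete
  subgraph on \<open>k\<close> vertices, and every \<open>M \<ge> t\<close> gives the unrestricted optimum.
\<close>

definition optimum :: "nat \<Rightarrow> real" where
  "optimum M = turan_constant p a b * uniform_value p a b (min M t)"

lemma turan_constant_pos: "0 < turan_constant p a b"
  by (simp add: turan_constant_def)

lemma optimum_pos:
  assumes "a + b \<le> M"
  shows "0 < optimum M"
  unfolding optimum_def using turan_constant_pos uniform_value_pos[OF two_parts_positive] turning_point_ge assms
  by (intro mult_pos_pos) auto

lemma turan_poly_list_le:
  fixes x :: "nat \<Rightarrow> real"
  assumes M: "a + b \<le> M" "m \<le> M" and x: "\<And>i. i < m \<Longrightarrow> 0 < x i" "sum x {..<m} = 1"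
  shows "turan_constant p a b * turan_poly p a b {..<m} x \<le> optimum M"
    and "turan_constant p a b * turan_poly p a b {..<m} x = optimum M \<Longrightarrow>
      m = min M t \<and> (\<forall>i<m. x i = 1 / real m)"
proof -
  let ?K = "turan_constant p a b" and ?f = "turan_poly p a b {..<m}"
  define y where "y i = (if i < m then x i else 0)" for i
  have fy: "?f x = ?f y" by (rule turan_poly_cong) (simp add: y_def)
  have "sum y {..<m} = sum x {..<m}" by (intro sum.cong) (auto simp: y_def)
  then have y: "y \<in> simplex_on {..<m}" using x by (auto simp: simplex_on_def y_def less_imp_le)
  have supp: "{i \<in> {..<m}. y i \<noteq> 0} = {..<m}" using less_imp_neq[OF x(1)] by (fastforce simp: y_def)
  show le: "?K * ?f x \<le> optimum M"
  proof (cases "a + b \<le> m")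
    case True
    have "?f y \<le> uniform_value p a b (min m t)"
      using turan_poly_le_uniform_value(1)[of "{..<m}" y] y True by simp
    also have "\<dots> \<le> uniform_value p a b (min M t)"
      using uniform_value_le(1)[of "min m t" M] True M turning_point_ge by simp
    finally show ?thesis unfolding optimum_def fy using turan_constant_pos by simp
  next
    case False
    then have "?f x = 0" by (simp add: turan_poly_def part_pairs_empty)
    then show ?thesis using optimum_pos[OF M(1)] by simp
  qed
  assume eq: "?K * ?f x = optimum M"
  then have "?f x \<noteq> 0" using optimum_pos[OF M(1)] by auto
  then have am: "a + b \<le> m" by (metis (no_types, lifting) card_lessThan finite_lessThan linorder_not_le part_pairs_empty sum.empty turan_poly_def)
  have fM: "?f y = uniform_value p a b (min M t)"
    using eq turan_constant_pos unfolding optimum_def fy by simp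
  have le1: "?f y \<le> uniform_value p a b (min m t)"
    using turan_poly_le_uniform_value(1)[of "{..<m}" y] y am by simp
  have le2: "uniform_value p a b (min m t) \<le> uniform_value p a b (min M t)"
    using uniform_value_le(1)[of "min m t" M] am M turning_point_ge by simp
  have *: "?f y = uniform_value p a b (min m t)" "uniform_value p a b (min m t) = uniform_value p a b (min M t)"
    using fM le1 le2 by simp_all
  have "card {i \<in> {..<m}. y i \<noteq> 0} = min m t \<and> (\<forall>i\<in>{..<m}. y i \<noteq> 0 \<longrightarrow> y i = 1 / real (min m t))"
    using turan_poly_le_uniform_value(2)[of "{..<m}" y] y am *(1) by simp
  then have mt: "m = min m t" and val: "\<And>i. i < m \<Longrightarrow> y i \<noteq> 0 \<Longrightarrow> y i = 1 / real (min m t)"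
    unfolding supp by auto
  have "min m t = min M t" using uniform_value_le(2)[of "min m t" M] am M turning_point_ge *(2) by simp
  moreover have "x i = 1 / real m" if "i < m" for i
    using val[OF that] x(1)[OF that] that mt by (simp add: y_def)
  ultimately show "m = min M t \<and> (\<forall>i<m. x i = 1 / real m)" using mt by simp
qed

lemma induced_density_le:
  assumes ys: "part_weights ys" "length ys \<le> M" and M: "a + b \<le> M"
  shows "induced_density T (multipartite_graphon ys) \<le> optimum M"
    and "induced_density T (multipartite_graphon ys) = optimum M \<Longrightarrow>
      ys = replicate (min M t) (1 / real (min M t))"
proof -
  have pos: "0 < ys ! i" if "i < length ys" for i using ys(1) that by (simp add: part_weights_def)
  have sum: "(\<Sum>i<length ys. ys ! i) = 1"
    using ys(1) by (simp add: part_weights_def sum_list_sum_nth atLeast0LessThan)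
  note D = induced_density_multipartite[OF ys(1) p_pos s_eq T_eq finite_W card_W profile]
  show "induced_density T (multipartite_graphon ys) \<le> optimum M"
    unfolding D by (rule turan_poly_list_le(1)[OF M ys(2) pos sum])
  assume "induced_density T (multipartite_graphon ys) = optimum M"
  then have "length ys = min M t \<and> (\<forall>i<length ys. ys ! i = 1 / real (length ys))"
    unfolding D using turan_poly_list_le(2)[OF M ys(2) pos sum] by blast
  then show "ys = replicate (min M t) (1 / real (min M t))"
    by (intro nth_equalityI) auto
qed

lemma min_positive:
  assumes "a + b \<le> M"
  shows "0 < min M t" "a + b \<le> min M t"
  using assms turning_point_ge two_parts_positive by linarith+

lemma part_weights_uniform: "0 < l \<Longrightarrow> part_weights (replicate l (1 / real l))"
  by (auto simp: part_weights_def sum_list_replicate)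

lemma induced_density_uniform:
  assumes M: "a + b \<le> M"
  shows "induced_density T (multipartite_graphon (replicate (min M t) (1 / real (min M t)))) = optimum M"
proof -
  let ?l = "min M t"
  have "turan_poly p a b {..<?l} ((!) (replicate ?l (1 / real ?l))) = uniform_value p a b (card {..<?l})"
    by (rule turan_poly_uniform) auto
  then show ?thesis
    using induced_density_multipartite[OF part_weights_uniform[OF min_positive(1)[OF M]] p_pos s_eq T_eq finite_W card_W profile]
    by (simp only: optimum_def length_replicate card_lessThan)
qed

text \<open>
  The probability that \<open>s\<close> vertices drawn with replacement are distinct.
\<close>

definition sampling_ratio :: "nat \<Rightarrow> real" where
  "sampling_ratio n = fact s * real (n choose s) / real n ^ s"

lemma sampling_ratio_pos: "0 < s \<Longrightarrow> s \<le> n \<Longrightarrow> 0 < sampling_ratio n"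
  by (simp add: sampling_ratio_def)

lemma s_pos: "0 < s"
  using s_eq p_pos two_parts_positive by auto

text \<open>
  After symmetrisation the host is complete multipartite with at most \<open>M\<close> parts: either because it has
  no larger clique, or because it has only \<open>n \<le> M\<close> vertices.
\<close>

lemma induced_freq_le:
  fixes G :: "nat sgraph"
  assumes G: "simple_graph G" "card (verts G) = n" and M: "a + b \<le> M" and n: "s \<le> n"
    and free: "n \<le> M \<or> \<not> contains_complete (Suc M) G"
  shows "induced_freq T G \<le> optimum M / sampling_ratio n"
proof -
  have n0: "0 < n" using n s_pos by simp
  obtain d :: "nat \<Rightarrow> nat" and m where d: "d ` verts G = {..<m}"
    and le: "induced_copies T G \<le> induced_copies T (label_graph (verts G) d)"
    and m: "\<And>k. \<not> contains_complete k G \<Longrightarrow> m < k"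
    using exists_multipartite_with_more_copies[OF G(1) T_eq] by blast
  let ?V = "verts G" and ?x = "\<lambda>i. real (card {v \<in> verts G. d v = i}) / real n"
  have V: "finite ?V" using G by (simp add: simple_graph_def)
  have "m = card (d ` ?V)" by (simp add: d)
  also have "\<dots> \<le> n" using V G(2) card_image_le by blast
  finally have mM: "m \<le> M" using free m[of "Suc M"] by auto
  have pos: "0 < ?x i" if "i < m" for i
  proof -
    have "i \<in> d ` ?V" using that d by simp
    then have "{v \<in> ?V. d v = i} \<noteq> {}" by blast
    then have "0 < card {v \<in> ?V. d v = i}" using V by (simp add: card_gt_0_iff)
    then show ?thesis using n0 by simp
  qed
  have "(\<Sum>i<m. card {v \<in> ?V. d v = i}) = n" using sum_class_sizes[OF V, of "{..<m}" d] d G(2) by simp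
  then have "(\<Sum>i<m. real (card {v \<in> ?V. d v = i})) = real n" by (metis of_nat_sum)
  then have sum: "sum ?x {..<m} = 1" using n0 by (simp flip: sum_divide_distrib)
  have "fact s * real (induced_copies T G) \<le> fact s * real (induced_copies T (label_graph ?V d))"
    using le by simp
  also have "\<dots> \<le> real n ^ s * (turan_constant p a b * turan_poly p a b {..<m} ?x)"
    using induced_copies_bounds(1)[OF V G(2) n0, of "{..<m}" d] d by simp
  also have "\<dots> \<le> real n ^ s * optimum M"
    by (intro mult_left_mono turan_poly_list_le(1)[OF M mM pos sum]) auto
  finally have "fact s * real (induced_copies T G) \<le> real n ^ s * optimum M" .
  moreover have "0 < real (n choose s)" using n by simp
  ultimately show ?thesis
    unfolding induced_freq_def sampling_ratio_def card_verts G(2) using n0 by (simp add: field_simps)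
qed

lemma induced_freq_balanced_ge:
  assumes l: "0 < l" and n: "s \<le> n"
  shows "(turan_constant p a b * turan_poly p a b {..<l} (\<lambda>i. real (card {v \<in> {..<n}. v mod l = i}) / real n)
    - (1 - sampling_ratio n)) / sampling_ratio n \<le> induced_freq T (label_graph {..<n} (\<lambda>v. v mod l))"
proof -
  have n0: "0 < n" using n s_pos by simp
  have im: "(\<lambda>v. v mod l) ` {..<n} \<subseteq> {..<l}" using l by auto
  let ?D = "turan_constant p a b * turan_poly p a b {..<l} (\<lambda>i. real (card {v \<in> {..<n}. v mod l = i}) / real n)"
  have "real n ^ s * ?D \<le> fact s * real (induced_copies T (label_graph {..<n} (\<lambda>v. v mod l)))
      + (real n ^ s - fact s * real (n choose s))"
    by (rule induced_copies_bounds(2)[OF _ _ n0 _ im]) auto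
  then have "?D \<le> (fact s * real (induced_copies T (label_graph {..<n} (\<lambda>v. v mod l)))
      + (real n ^ s - fact s * real (n choose s))) / real n ^ s"
    using n0 by (simp add: pos_le_divide_eq mult.commute)
  also have "\<dots> = sampling_ratio n * induced_freq T (label_graph {..<n} (\<lambda>v. v mod l)) + (1 - sampling_ratio n)"
    using n0 n unfolding sampling_ratio_def induced_freq_def card_verts verts_label_graph
    by (simp add: add_divide_distrib diff_divide_distrib)
  finally show ?thesis
    using sampling_ratio_pos[OF s_pos n] by (simp add: pos_divide_le_eq mult.commute algebra_simps)
qed

text \<open>
  Both the restricted and the unrestricted maximum are squeezed between the frequency in the balanced
  complete multipartite graph and the upper bound, since \<^const>\<open>sampling_ratio\<close> tends to \<open>1\<close>.
\<close>

lemma frequency_limit: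
  assumes M: "a + b \<le> M"
    and lower: "\<And>n. s \<le> n \<Longrightarrow> induced_freq T (label_graph {..<n} (\<lambda>v. v mod min M t)) \<le> F n"
    and upper: "\<And>n. s \<le> n \<Longrightarrow> F n \<le> optimum M / sampling_ratio n"
  shows "lim F = optimum M"
proof -
  let ?l = "min M t"
  have ratio: "sampling_ratio \<longlonglongrightarrow> 1" unfolding sampling_ratio_def by (rule falling_factorial_ratio_tendsto_1)
  let ?D = "\<lambda>n. turan_constant p a b * turan_poly p a b {..<?l} (\<lambda>i. real (card {v \<in> {..<n}. v mod ?l = i}) / real n)"
  have "?D \<longlonglongrightarrow> turan_constant p a b * turan_poly p a b {..<?l} (\<lambda>i. 1 / real ?l)"
    by (intro tendsto_mult tendsto_const tendsto_turan_poly residue_class_density) (use min_positive[OF M] in auto)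
  also have "turan_poly p a b {..<?l} (\<lambda>i. 1 / real ?l) = uniform_value p a b (card {..<?l})"
    by (rule turan_poly_uniform) auto
  finally have D: "?D \<longlonglongrightarrow> optimum M" by (simp add: optimum_def)
  have "F \<longlonglongrightarrow> optimum M"
  proof (rule tendsto_sandwich)
    show "eventually (\<lambda>n. (?D n - (1 - sampling_ratio n)) / sampling_ratio n \<le> F n) sequentially"
      using eventually_ge_at_top[of s]
      by eventually_elim (use order.trans[OF induced_freq_balanced_ge lower] min_positive[OF M] in blast)
    show "eventually (\<lambda>n. F n \<le> optimum M / sampling_ratio n) sequentially"
      using eventually_ge_at_top[of s] by eventually_elim (rule upper)
    have "(\<lambda>n. (?D n - (1 - sampling_ratio n)) / sampling_ratio n) \<longlonglongrightarrow> (optimum M - (1 - 1)) / 1"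
      by (intro tendsto_divide tendsto_diff tendsto_const D ratio) simp
    then show "(\<lambda>n. (?D n - (1 - sampling_ratio n)) / sampling_ratio n) \<longlonglongrightarrow> optimum M" by simp
    have "(\<lambda>n. optimum M / sampling_ratio n) \<longlonglongrightarrow> optimum M / 1"
      by (intro tendsto_divide tendsto_const ratio) simp
    then show "(\<lambda>n. optimum M / sampling_ratio n) \<longlonglongrightarrow> optimum M" by simp
  qed
  then show ?thesis by (rule limI)
qed

lemma inducibility_free_eq:
  assumes k: "a + b < k"
  shows "inducibility_free k T = optimum (k - 1)"
  unfolding inducibility_free_def
proof (rule frequency_limit)
  show M: "a + b \<le> k - 1" using k by simp
  let ?l = "min (k - 1) t"
  let ?X = "\<lambda>n. {induced_freq T G | G :: nat sgraph. simple_graph G \<and> card (verts G) = n \<and> \<not> contains_complete k G}"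
  fix n assume n: "s \<le> n"
  have "\<not> contains_complete k (label_graph {..<n} (\<lambda>v. v mod ?l))"
  proof (rule label_graph_not_contains_complete[of "{..<?l}"])
    show "(\<lambda>v. v mod ?l) ` {..<n} \<subseteq> {..<?l}"
      using mod_less_divisor[OF min_positive(1)[OF M]] by blast
  qed (use k in auto)
  then have mem: "induced_freq T (label_graph {..<n} (\<lambda>v. v mod ?l)) \<in> ?X n"
    using simple_label_graph[of "{..<n}"] by (intro CollectI exI[of _ "label_graph {..<n} (\<lambda>v. v mod ?l)"]) auto
  then show "induced_freq T (label_graph {..<n} (\<lambda>v. v mod ?l)) \<le> max_freq_free k T n"
    unfolding max_freq_free_def by (rule Max_ge[OF finite_frequencies_free])
  show "max_freq_free k T n \<le> optimum (k - 1) / sampling_ratio n"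
    unfolding max_freq_free_def
  proof (rule Max.boundedI[OF finite_frequencies_free])
    show "?X n \<noteq> {}" using mem by blast
    fix f assume "f \<in> ?X n"
    then obtain G :: "nat sgraph" where "f = induced_freq T G" "simple_graph G" "card (verts G) = n" "\<not> contains_complete k G"
      by blast
    then show "f \<le> optimum (k - 1) / sampling_ratio n"
      using induced_freq_le[of G n "k - 1"] M n k by simp
  qed
qed

lemma optimum_eq_of_ge: "t \<le> M \<Longrightarrow> optimum M = optimum t"
  by (simp add: optimum_def min_absorb2)

text \<open>
  Hosts on \<open>n\<close> vertices have at most \<open>n\<close> parts, and \<open>optimum M\<close> no longer depends on \<open>M\<close> once
  \<open>M \<ge> t\<close>. So \<open>M = max n t\<close> gives a bound that is uniform in \<open>n\<close>.
\<close>

lemma inducibility_eq: "inducibility T = optimum t"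
  unfolding inducibility_def
proof (rule frequency_limit)
  show M: "a + b \<le> t" by (rule turning_point_ge)
  let ?X = "\<lambda>n. {induced_freq T G | G :: nat sgraph. simple_graph G \<and> card (verts G) = n}"
  fix n assume n: "s \<le> n"
  have mem: "induced_freq T (label_graph {..<n} (\<lambda>v. v mod min t t)) \<in> ?X n"
    using simple_label_graph[of "{..<n}"] by (intro CollectI exI[of _ "label_graph {..<n} (\<lambda>v. v mod min t t)"]) auto
  then show "induced_freq T (label_graph {..<n} (\<lambda>v. v mod min t t)) \<le> max_freq T n"
    unfolding max_freq_def by (rule Max_ge[OF finite_frequencies])
  show "max_freq T n \<le> optimum t / sampling_ratio n"
    unfolding max_freq_def
  proof (rule Max.boundedI[OF finite_frequencies])
    show "?X n \<noteq> {}" using mem by blast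
    fix f assume "f \<in> ?X n"
    then obtain G :: "nat sgraph" where "f = induced_freq T G" "simple_graph G" "card (verts G) = n" by blast
    then show "f \<le> optimum t / sampling_ratio n"
      using induced_freq_le[of G n "max n t"] M n optimum_eq_of_ge[of "max n t"] by simp
  qed
qed

theorem uniquely_attains_free_uniform:
  assumes k: "a + b < k"
  shows "uniquely_attains_free k T (replicate (min (k - 1) t) (1 / real (min (k - 1) t)))"
proof -
  have M: "a + b \<le> k - 1" using k by simp
  show ?thesis
    unfolding uniquely_attains_free_def inducibility_free_eq[OF k]
  proof (intro conjI allI impI)
    show "part_weights (replicate (min (k - 1) t) (1 / real (min (k - 1) t)))"
      by (rule part_weights_uniform[OF min_positive(1)[OF M]])
    show "length (replicate (min (k - 1) t) (1 / real (min (k - 1) t))) < k" using k by auto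
    fix ys assume "part_weights ys \<and> length ys < k \<and> induced_density T (multipartite_graphon ys) = optimum (k - 1)"
    moreover from this have "length ys \<le> k - 1" by linarith
    ultimately have "ys = replicate (min (k - 1) t) (1 / real (min (k - 1) t))"
      using induced_density_le(2)[OF _ _ M] by blast
    then show "mset ys = mset (replicate (min (k - 1) t) (1 / real (min (k - 1) t)))" by (rule arg_cong)
  qed (rule induced_density_uniform[OF M])
qed

theorem uniquely_attains_uniform: "uniquely_attains T (replicate t (1 / real t))"
  unfolding uniquely_attains_def inducibility_eq
proof (intro conjI allI impI)
  show "part_weights (replicate t (1 / real t))"
    using part_weights_uniform min_positive(1)[OF turning_point_ge] by simp
  show "induced_density T (multipartite_graphon (replicate t (1 / real t))) = optimum t"
    using induced_density_uniform[OF turning_point_ge] by simp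
  fix ys assume ys: "part_weights ys \<and> induced_density T (multipartite_graphon ys) = optimum t"
  let ?M = "max (length ys) t"
  have "a + b \<le> ?M" "min ?M t = t" using turning_point_ge by auto
  then have "ys = replicate t (1 / real t)"
    using induced_density_le(2)[of ys ?M] ys optimum_eq_of_ge[of ?M] by simp
  then show "mset ys = mset (replicate t (1 / real t))" by (rule arg_cong)
qed

end

theorem theorem1p6:
  fixes r s k t l p q :: nat and T :: "'a sgraph"
  assumes "2 \<le> r" and "r < s" and "s \<le> 3 * r + 1" and "r < k"
    and "t = (GREATEST u. r \<le> u \<and>
      (u = r \<or> real u / (real u - real r) * (1 - 1 / real u) ^ s > 1))"
    and "l = min (k - 1) t"
    and "s = p * r + q" and "q < r"
    and "is_turan_graph s r T"
  shows "uniquely_attains_free k T (replicate l (1 / real l)) \<and>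
    uniquely_attains T (replicate t (1 / real t)) \<and>
    inducibility_free k T =
      (fact l * fact s) /
      (fact (l - r) * fact (r - q) * fact q * fact p ^ r * (real p + 1) ^ q * real l ^ s) \<and>
    inducibility T =
      (fact t * fact s) /
      (fact (t - r) * fact (r - q) * fact q * fact p ^ r * (real p + 1) ^ q * real t ^ s)"
proof -
  define a where "a = r - q"
  have r: "r = a + q" using assms(8) by (simp add: a_def)
  have p: "0 < p"
  proof (rule ccontr)
    assume "\<not> 0 < p"
    then have "s = q" using assms(7) by simp
    then show False using assms(2,8) by simp
  qed
  have s: "s = p * (a + q) + q" using assms(7) r by simp
  have big: "2 \<le> p \<or> 0 < q"
  proof (rule ccontr)
    assume "\<not> (2 \<le> p \<or> 0 < q)"
    then have "p = 1" "q = 0" using p by auto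
    then show False using assms(2,7) by simp
  qed
  obtain c :: "'a \<Rightarrow> nat" where c: "T = label_graph (verts T) c" "finite (verts T)" "card (verts T) = s"
    "class_count (verts T) c = turan_profile p a q"
    using turan_graph_eq_label_graph[OF assms(9,7,8) p] unfolding a_def by blast
  interpret turan_extremal T p a q s "verts T" c t
  proof
    show "2 \<le> a + q" using assms(1) r by simp
    show "t = (GREATEST u. a + q \<le> u \<and> (u = a + q \<or> growth_ratio (a + q) (p * (a + q) + q) u > 1))"
      using assms(5) unfolding r s .
  qed (fact p s c big)+
  have k: "a + q < k" using assms(4) r by simp
  have l: "a + q \<le> l" using min_positive(2)[of "k - 1"] k assms(6) by simp
  have formula: "turan_constant p a q * uniform_value p a q u =
      (fact u * fact s) / (fact (u - r) * fact (r - q) * fact q * fact p ^ r * (real p + 1) ^ q * real u ^ s)"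
    if "a + q \<le> u" for u
    unfolding turan_constant_def uniform_value_eq[OF that] r[symmetric] a_def[symmetric] assms(7)[symmetric]
    by (simp add: mult_ac)
  have "optimum (k - 1) = turan_constant p a q * uniform_value p a q l"
    "optimum t = turan_constant p a q * uniform_value p a q t"
    using assms(6) by (simp_all add: optimum_def)
  then show ?thesis
    using uniquely_attains_free_uniform[OF k] uniquely_attains_uniform inducibility_free_eq[OF k] inducibility_eq
      formula[OF l] formula[OF turning_point_ge] unfolding assms(6)[symmetric] by simp
qed

end
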